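(* Let $k\ge 0$ and $n\ge (k+2)^2$ be integers, and let $G$ be a balanced bipartite graph on $2n$ vertices with minimum degree $\delta(G)\ge k$. (1) If $k\ne 1$ and $\rho(G)\ge\rho(Q_n^k)$, then $G$ is traceable unless $G=Q_n^k$. (2) If $k=1$ and $\rho(G)\ge\rho(R_n^1)$, then $G$ is traceable unless $G=R_n^1$.
   Context: Graphs are finite and simple. A bipartite graph comes with a fixed bipartition $\{X,Y\}$ (parts may be empty); it is balanced if $|X|=|Y|$. A graph is traceable if it contains a spanning path (Hamilton path). $\rho(G)$ is the spectral radius (largest eigenvalue of the adjacency matrix). Equality of graphs is up to isomorphism. $K_{m,n}$ is the complete bipartite graph with parts of sizes $|X|=m$, $|Y|=n$, and $\varPhi_{m,n}$ is the edgeless bipartite graph with parts of sizes $|X|=m$, $|Y|=n$. For bipartite graphs $G_1,G_2$ with bipartitions $\{X_1,Y_1\}$, $\{X_2,Y_2\}$, $G_1\sqcup G_2$ is the graph obtained from the disjoint union $G_1\cup G_2$ by adding all edges between $X_1$ and $Y_2$ and all edges between $Y_1$ and $X_2$ (its parts are $X_1\cup X_2$ and $Y_1\cup Y_2$). Define $Q_n^k=K_{k,n-k-1}\sqcup\varPhi_{n-k,k+1}$ for $0\le k\le (n-1)/2$, and $R_n^k=K_{k,k}\cup K_{n-k,n-k}$ (disjoint union) for $1\le k\le n/2$. *)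

theory Defs
  imports
    "Graph_Theory.Graph_Theory"
    "Jordan_Normal_Form.Spectral_Radius"
begin

section \<open>Graphs\<close>

text \<open>
  A finite simple graph is a \<open>pair_graph\<close>: an edge \<open>uv\<close> is represented by the two arcs
  \<open>(u, v)\<close> and \<open>(v, u)\<close>, so that the degree of a vertex is its out-degree.
\<close>

definition min_degree :: "'a pair_pre_digraph \<Rightarrow> nat" where
  "min_degree G = Min (out_degree (with_proj G) ` pverts G)"

definition traceable :: "'a pair_pre_digraph \<Rightarrow> bool" where
  "traceable G \<longleftrightarrow> (\<exists>p. vpath p (with_proj G) \<and> set p = pverts G)"

definition isomorphic :: "'a pair_pre_digraph \<Rightarrow> 'b pair_pre_digraph \<Rightarrow> bool" where
  "isomorphic G H \<longleftrightarrow> digraph_iso (with_proj G) (with_proj H)"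


section \<open>Spectral radius\<close>

definition adj_matrix :: "'a pair_pre_digraph \<Rightarrow> 'a list \<Rightarrow> real mat" where
  "adj_matrix G vs =
     mat (length vs) (length vs) (\<lambda>(i, j). if (vs ! i, vs ! j) \<in> parcs G then 1 else 0)"

text \<open>
  The vertices are listed in an arbitrary order; the spectrum does not depend on it, see
  \<open>spectrum_adj_matrix_unique\<close>. The adjacency matrix is real symmetric, hence all its
  eigenvalues are real and \<open>spectrum\<close> over the reals loses none of them.
\<close>

definition graph_spectral_radius :: "'a pair_pre_digraph \<Rightarrow> real" where
  "graph_spectral_radius G =
     Max (spectrum (adj_matrix G (SOME vs. distinct vs \<and> set vs = pverts G)))"

lemma adj_matrix_mult_vec_index:
  assumes "distinct vs" "i < length vs"
  shows "(adj_matrix G vs *\<^sub>v vec (length vs) (\<lambda>j. f (vs ! j))) $ i =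
         (\<Sum>w\<in>set vs. if (vs ! i, w) \<in> parcs G then f w else 0)"
proof -
  have "(adj_matrix G vs *\<^sub>v vec (length vs) (\<lambda>j. f (vs ! j))) $ i =
        (\<Sum>j<length vs. if (vs ! i, vs ! j) \<in> parcs G then f (vs ! j) else 0)"
    using assms(2) by (auto simp: adj_matrix_def scalar_prod_def atLeast0LessThan intro!: sum.cong)
  also have "\<dots> = (\<Sum>w\<in>set vs. if (vs ! i, w) \<in> parcs G then f w else 0)"
    by (rule sum.reindex_bij_betw[OF bij_betw_nth]) (use assms in auto)
  finally show ?thesis .
qed

lemma eigenvalue_adj_matrix_iff:
  assumes "distinct vs"
  shows "eigenvalue (adj_matrix G vs) l \<longleftrightarrow>
    (\<exists>f. (\<exists>v\<in>set vs. f v \<noteq> 0) \<and>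
         (\<forall>v\<in>set vs. (\<Sum>w\<in>set vs. if (v, w) \<in> parcs G then f w else 0) = l * f v))"
    (is "?L \<longleftrightarrow> (\<exists>f. ?R f)")
proof
  assume ?L
  then obtain x where x: "x \<in> carrier_vec (length vs)" "x \<noteq> 0\<^sub>v (length vs)"
      "adj_matrix G vs *\<^sub>v x = l \<cdot>\<^sub>v x"
    by (auto simp: eigenvalue_def eigenvector_def adj_matrix_def)
  define f where "f v = x $ the_inv_into {..<length vs} ((!) vs) v" for v
  have f: "f (vs ! i) = x $ i" if "i < length vs" for i
    unfolding f_def using that assms by (subst the_inv_into_f_f) (auto simp: inj_on_nth)
  have xf: "x = vec (length vs) (\<lambda>j. f (vs ! j))"
    using x(1) f by auto
  have "\<exists>i<length vs. x $ i \<noteq> 0"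
    using x(1,2) by auto
  then have "\<exists>v\<in>set vs. f v \<noteq> 0"
    using f by (metis nth_mem)
  moreover have "(\<Sum>w\<in>set vs. if (vs ! i, w) \<in> parcs G then f w else 0) = l * f (vs ! i)"
    if "i < length vs" for i
    using adj_matrix_mult_vec_index[OF assms that, of G f] x that f unfolding xf[symmetric] by auto
  ultimately have "?R f"
    by (auto simp: in_set_conv_nth)
  then show "\<exists>f. ?R f"
    by (rule exI[of _ f])
next
  assume "\<exists>f. ?R f"
  then obtain f where f: "?R f"
    by (rule exE)
  let ?x = "vec (length vs) (\<lambda>j. f (vs ! j))"
  obtain i where i: "i < length vs" "f (vs ! i) \<noteq> 0"
    using f by (auto simp: in_set_conv_nth)
  have "?x \<noteq> 0\<^sub>v (length vs)"
  proof
    assume "?x = 0\<^sub>v (length vs)"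
    then have "?x $ i = 0" using i by simp
    then show False using i by simp
  qed
  moreover have "adj_matrix G vs *\<^sub>v ?x = l \<cdot>\<^sub>v ?x"
  proof
    fix i assume "i < dim_vec (l \<cdot>\<^sub>v ?x)"
    then show "(adj_matrix G vs *\<^sub>v ?x) $ i = (l \<cdot>\<^sub>v ?x) $ i"
      using f by (simp add: adj_matrix_mult_vec_index[OF assms])
  qed (simp add: adj_matrix_def)
  ultimately show ?L
    unfolding eigenvalue_def eigenvector_def by (intro exI[of _ ?x]) (auto simp: adj_matrix_def)
qed

lemma spectrum_adj_matrix_unique:
  assumes "distinct vs" "distinct ws" "set vs = set ws"
  shows "spectrum (adj_matrix G vs) = spectrum (adj_matrix G ws)"
  using assms by (auto simp: spectrum_def eigenvalue_adj_matrix_iff)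

lemma graph_spectral_radius_eq:
  assumes "distinct vs" "set vs = pverts G"
  shows "graph_spectral_radius G = Max (spectrum (adj_matrix G vs))"
proof -
  let ?P = "\<lambda>vs. distinct vs \<and> set vs = pverts G"
  have "?P (SOME vs. ?P vs)"
    by (rule someI[of ?P vs]) (use assms in simp)
  then show ?thesis
    unfolding graph_spectral_radius_def
    using spectrum_adj_matrix_unique[of "SOME vs. ?P vs" vs G] assms by simp
qed


section \<open>Bipartite graphs\<close>

record 'a bigraph =
  ugraph :: "'a pair_pre_digraph"
  part_X :: "'a set"
  part_Y :: "'a set"

definition bipartite_graph :: "'a bigraph \<Rightarrow> bool" where
  "bipartite_graph B \<longleftrightarrow>
     pair_graph (ugraph B) \<and>
     pverts (ugraph B) = part_X B \<union> part_Y B \<and>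
     part_X B \<inter> part_Y B = {} \<and>
     parcs (ugraph B) \<subseteq> part_X B \<times> part_Y B \<union> part_Y B \<times> part_X B"

definition balanced :: "'a bigraph \<Rightarrow> bool" where
  "balanced B \<longleftrightarrow> card (part_X B) = card (part_Y B)"

definition mk_bigraph :: "'a set \<Rightarrow> 'a set \<Rightarrow> ('a \<times> 'a) set \<Rightarrow> 'a bigraph" where
  "mk_bigraph X Y E =
     \<lparr>ugraph = \<lparr>pverts = X \<union> Y, parcs = E \<union> E\<inverse>\<rparr>, part_X = X, part_Y = Y\<rparr>"

definition complete_bigraph :: "nat \<Rightarrow> nat \<Rightarrow> (nat + nat) bigraph" where
  "complete_bigraph m n =
     mk_bigraph (Inl ` {..<m}) (Inr ` {..<n}) (Inl ` {..<m} \<times> Inr ` {..<n})"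

definition empty_bigraph :: "nat \<Rightarrow> nat \<Rightarrow> (nat + nat) bigraph" where
  "empty_bigraph m n = mk_bigraph (Inl ` {..<m}) (Inr ` {..<n}) {}"

definition bigraph_union :: "'a bigraph \<Rightarrow> 'b bigraph \<Rightarrow> ('a + 'b) bigraph" where
  "bigraph_union A B =
     \<lparr>ugraph =
        \<lparr>pverts = pverts (ugraph A) <+> pverts (ugraph B),
         parcs = map_prod Inl Inl ` parcs (ugraph A) \<union> map_prod Inr Inr ` parcs (ugraph B)\<rparr>,
      part_X = part_X A <+> part_X B,
      part_Y = part_Y A <+> part_Y B\<rparr>"

text \<open>The operation \<open>A \<squnion> B\<close>.\<close>

definition bigraph_join :: "'a bigraph \<Rightarrow> 'b bigraph \<Rightarrow> ('a + 'b) bigraph" where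
  "bigraph_join A B =
     (let U = bigraph_union A B;
          E = Inl ` part_X A \<times> Inr ` part_Y B \<union> Inl ` part_Y A \<times> Inr ` part_X B
      in U\<lparr>ugraph := \<lparr>pverts = pverts (ugraph U), parcs = parcs (ugraph U) \<union> E \<union> E\<inverse>\<rparr>\<rparr>)"

text \<open>
  Intended for \<open>2 * k + 1 \<le> n\<close> and for \<open>1 \<le> k\<close>, \<open>2 * k \<le> n\<close>, respectively;
  then the subtractions do not truncate.
\<close>

definition Q_graph :: "nat \<Rightarrow> nat \<Rightarrow> ((nat + nat) + (nat + nat)) bigraph" where
  "Q_graph n k = bigraph_join (complete_bigraph k (n - k - 1)) (empty_bigraph (n - k) (k + 1))"

definition R_graph :: "nat \<Rightarrow> nat \<Rightarrow> ((nat + nat) + (nat + nat)) bigraph" where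
  "R_graph n k = bigraph_union (complete_bigraph k k) (complete_bigraph (n - k) (n - k))"

lemma bipartite_graph_iff:
  "bipartite_graph B \<longleftrightarrow>
     finite (part_X B) \<and> finite (part_Y B) \<and>
     pverts (ugraph B) = part_X B \<union> part_Y B \<and>
     part_X B \<inter> part_Y B = {} \<and>
     parcs (ugraph B) \<subseteq> part_X B \<times> part_Y B \<union> part_Y B \<times> part_X B \<and>
     sym (parcs (ugraph B))"
proof
  assume B: "bipartite_graph B"
  then interpret pair_graph "ugraph B" by (simp add: bipartite_graph_def)
  from B show "finite (part_X B) \<and> finite (part_Y B) \<and>
     pverts (ugraph B) = part_X B \<union> part_Y B \<and>
     part_X B \<inter> part_Y B = {} \<and>
     parcs (ugraph B) \<subseteq> part_X B \<times> part_Y B \<union> part_Y B \<times> part_X B \<and>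
     sym (parcs (ugraph B))"
    using pair_finite_verts pair_sym_arcs by (auto simp: bipartite_graph_def symmetric_def)
next
  assume B: "finite (part_X B) \<and> finite (part_Y B) \<and>
     pverts (ugraph B) = part_X B \<union> part_Y B \<and>
     part_X B \<inter> part_Y B = {} \<and>
     parcs (ugraph B) \<subseteq> part_X B \<times> part_Y B \<union> part_Y B \<times> part_X B \<and>
     sym (parcs (ugraph B))"
  then have "finite (parcs (ugraph B))"
    by (meson finite_SigmaI finite_UnI finite_subset)
  with B have "pair_graph (ugraph B)"
    by unfold_locales (auto simp: symmetric_def)
  with B show "bipartite_graph B" by (simp add: bipartite_graph_def)
qed

lemma bipartite_complete_bigraph: "bipartite_graph (complete_bigraph m n)"
  by (auto simp: bipartite_graph_iff complete_bigraph_def mk_bigraph_def sym_def)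

lemma bipartite_empty_bigraph: "bipartite_graph (empty_bigraph m n)"
  by (auto simp: bipartite_graph_iff empty_bigraph_def mk_bigraph_def sym_def)

lemma sym_map_prod_image:
  assumes "sym r"
  shows "sym (map_prod g g ` r)"
proof (rule symI)
  fix a b assume "(a, b) \<in> map_prod g g ` r"
  then obtain x y where xy: "(x, y) \<in> r" "a = g x" "b = g y" by auto
  with assms have "map_prod g g (y, x) \<in> map_prod g g ` r"
    by (intro imageI) (rule symD)
  with xy show "(b, a) \<in> map_prod g g ` r" by simp
qed

lemma bipartite_bigraph_union:
  assumes "bipartite_graph A" "bipartite_graph B"
  shows "bipartite_graph (bigraph_union A B)"
proof -
  have "sym (map_prod Inl Inl ` parcs (ugraph A) \<union> map_prod Inr Inr ` parcs (ugraph B))"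
    using assms by (intro sym_Un sym_map_prod_image) (simp_all add: bipartite_graph_iff)
  moreover have "map_prod Inl Inl ` parcs (ugraph A) \<union> map_prod Inr Inr ` parcs (ugraph B) \<subseteq>
      (part_X A <+> part_X B) \<times> (part_Y A <+> part_Y B) \<union>
      (part_Y A <+> part_Y B) \<times> (part_X A <+> part_X B)"
    using assms by (force simp: bipartite_graph_iff)
  ultimately show ?thesis
    using assms by (auto simp: bipartite_graph_iff bigraph_union_def simp del: Un_subset_iff)
qed

lemma bipartite_bigraph_join:
  assumes "bipartite_graph A" "bipartite_graph B"
  shows "bipartite_graph (bigraph_join A B)"
proof -
  let ?U = "bigraph_union A B"
  let ?E = "Inl ` part_X A \<times> Inr ` part_Y B \<union> Inl ` part_Y A \<times> Inr ` part_X B"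
  have U: "bipartite_graph ?U"
    using assms by (rule bipartite_bigraph_union)
  have "sym (parcs (ugraph ?U) \<union> (?E \<union> ?E\<inverse>))"
    using U by (intro sym_Un sym_Un_converse) (simp add: bipartite_graph_iff)
  moreover have "?E \<union> ?E\<inverse> \<subseteq> part_X ?U \<times> part_Y ?U \<union> part_Y ?U \<times> part_X ?U"
    by (auto simp: bigraph_union_def)
  ultimately show ?thesis
    using U unfolding bipartite_graph_iff bigraph_join_def Let_def by (simp add: Un_assoc)
qed

lemma bipartite_Q_graph: "bipartite_graph (Q_graph n k)"
  by (simp add: Q_graph_def bipartite_bigraph_join bipartite_complete_bigraph
      bipartite_empty_bigraph)

lemma bipartite_R_graph: "bipartite_graph (R_graph n k)"
  by (simp add: R_graph_def bipartite_bigraph_union bipartite_complete_bigraph)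

lemma card_parts_Q_graph:
  assumes "2 * k + 1 \<le> n"
  shows "card (part_X (Q_graph n k)) = n" "card (part_Y (Q_graph n k)) = n"
  using assms
  by (simp_all add: Q_graph_def bigraph_join_def bigraph_union_def complete_bigraph_def
      empty_bigraph_def mk_bigraph_def Let_def card_Plus card_image)

lemma card_parts_R_graph:
  assumes "2 * k \<le> n"
  shows "card (part_X (R_graph n k)) = n" "card (part_Y (R_graph n k)) = n"
  using assms
  by (simp_all add: R_graph_def bigraph_union_def complete_bigraph_def
      mk_bigraph_def card_Plus card_image)

end

theory Submission
  imports Defs
begin

text \<open>
  Let \<open>G\<close> be a counterexample. Since \<open>\<rho>(G)\<^sup>2\<close> is at most the number of edges, \<open>G\<close> misses at most
  \<open>n (k + 1)\<close> of the \<open>n\<^sup>2\<close> possible edges. Pass to a maximal non-traceable supergraph \<open>H\<close>: following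
  a Hamilton path of \<open>H + xy\<close>, the successors of the neighbours of \<open>x\<close> are not neighbours of \<open>y\<close>,
  so nonadjacent \<open>x\<close>, \<open>y\<close> satisfy \<open>d(x) + d(y) \<le> n\<close>. A nonadjacent pair of maximal degree sum
  then forces, by counting missing edges, either \<open>k + 1\<close> vertices of degree at most \<open>k\<close> in one
  part, or \<open>k = 1\<close> and an isolated edge.

  These conclusions pass to \<open>G\<close> and suffice spectrally. Comparing an eigenfunction with a positive
  weight on one part, along walks of length two, bounds \<open>\<rho>(G)\<^sup>2\<close>. For \<open>k + 1\<close> vertices
  of degree at most \<open>k\<close>, the entries of the Perron vector of \<open>Q\<close> as weights give \<open>\<rho>(G) \<le> \<rho>(Q)\<close>
  with equality only for \<open>Q\<close>, whatever the neighbourhoods of these vertices; for \<open>k = 1\<close> the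
  weight \<open>1/3\<close> on them and \<open>1\<close> elsewhere gives \<open>\<rho>(G) < n - 1 \<le> \<rho>(R)\<close>.
\<close>

section \<open>Spanning paths\<close>

text \<open>A bipartite edge set is stored once, as a subset of \<open>X \<times> Y\<close>;
  adjacency along a path is its symmetric closure. Exchanging the two parts then amounts to passing
  to \<open>E\<inverse>\<close>.\<close>

definition edge :: "('a \<times> 'a) set \<Rightarrow> 'a \<Rightarrow> 'a \<Rightarrow> bool" where
  "edge E u v \<longleftrightarrow> (u, v) \<in> E \<or> (v, u) \<in> E"

definition path_in :: "('a \<times> 'a) set \<Rightarrow> 'a list \<Rightarrow> bool" where
  "path_in E p \<longleftrightarrow> distinct p \<and> successively (edge E) p"

definition spannable :: "'a set \<Rightarrow> ('a \<times> 'a) set \<Rightarrow> bool" where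
  "spannable V E \<longleftrightarrow> (\<exists>p. path_in E p \<and> set p = V)"

lemma edge_commute: "edge E u v \<longleftrightarrow> edge E v u"
  by (auto simp: edge_def)

lemma edge_converse [simp]: "edge (E\<inverse>) = edge E"
  by (auto simp: edge_def fun_eq_iff)

lemma path_in_converse [simp]: "path_in (E\<inverse>) p \<longleftrightarrow> path_in E p"
  by (simp add: path_in_def)

lemma spannable_converse [simp]: "spannable V (E\<inverse>) \<longleftrightarrow> spannable V E"
  by (simp add: spannable_def)

lemma path_in_append:
  "path_in E (p @ q) \<longleftrightarrow> path_in E p \<and> path_in E q \<and> set p \<inter> set q = {} \<and>
     (p = [] \<or> q = [] \<or> edge E (last p) (hd q))"
  by (auto simp: path_in_def successively_append_iff)

lemma path_in_rev [simp]: "path_in E (rev p) \<longleftrightarrow> path_in E p"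
  by (simp add: path_in_def edge_commute)

lemma path_in_Nil [simp]: "path_in E []"
  and path_in_single [simp]: "path_in E [v]"
  by (simp_all add: path_in_def)

lemma path_in_Cons:
  "path_in E (v # p) \<longleftrightarrow> v \<notin> set p \<and> (p = [] \<or> edge E v (hd p)) \<and> path_in E p"
  by (auto simp: path_in_def successively_Cons)

lemma path_in_insert_avoid:
  assumes "path_in (insert (x, y) E) q" "x \<notin> set q \<or> y \<notin> set q"
  shows "path_in E q"
  using assms unfolding path_in_def by (auto simp: edge_def elim!: successively_mono)

text \<open>A path that breaks without the new edge traverses it at some step. Cutting there, and
  reversing the path if it crosses from \<open>y\<close> to \<open>x\<close>, makes the first piece
  end in \<open>x\<close> and the second start in \<open>y\<close>.\<close>

lemma path_in_insert_split:
  assumes "path_in (insert (x, y) E) p" "\<not> path_in E p"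
  obtains us vs where "p = us @ vs \<or> rev p = us @ vs" "us \<noteq> []" "vs \<noteq> []"
    "last us = x" "hd vs = y"
proof -
  obtain i where i: "Suc i < length p" "\<not> edge E (p ! i) (p ! Suc i)"
    using assms by (auto simp: path_in_def successively_conv_nth)
  have e: "edge (insert (x, y) E) (p ! i) (p ! Suc i)"
    using assms(1) i by (auto simp: path_in_def successively_conv_nth)
  let ?us = "take (Suc i) p" and ?vs = "drop (Suc i) p"
  have l: "last ?us = p ! i" "hd ?vs = p ! Suc i" "?us \<noteq> []" "?vs \<noteq> []"
    using i by (auto simp: take_Suc_conv_app_nth hd_drop_conv_nth)
  from e i(2) consider "p ! i = x" "p ! Suc i = y" | "p ! i = y" "p ! Suc i = x"
    by (auto simp: edge_def)
  then show thesis
  proof cases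
    case 1
    then show thesis using l by (intro that[of ?us ?vs]) auto
  next
    case 2
    have "rev p = rev ?vs @ rev ?us"
      by (metis append_take_drop_id rev_append)
    then show thesis
      using 2 l by (intro that[of "rev ?vs" "rev ?us"]) (auto simp: last_rev hd_rev)
  qed
qed

text \<open>Vertices are appended in pairs, one of \<open>A\<close> and one of \<open>B\<close>;
  after each pair the path ends in \<open>B\<close>, so it is again adjacent to all that remains of
  \<open>A\<close>. The clause on the last vertex lets a caller continue the path.\<close>

lemma extend_path_zigzag:
  assumes "finite A" "finite B" "card A = card B" "A \<inter> B = {}"
    and "path_in E s" "s \<noteq> []" "set s \<inter> (A \<union> B) = {}"
    and "\<And>a b. a \<in> A \<Longrightarrow> b \<in> B \<Longrightarrow> edge E a b"
    and "\<And>a. a \<in> A \<Longrightarrow> edge E (last s) a"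
  shows "\<exists>q. path_in E (s @ q) \<and> set q = A \<union> B \<and> (A \<noteq> {} \<longrightarrow> last (s @ q) \<in> B)"
  using assms
proof (induction "card A" arbitrary: A B s)
  case 0
  then show ?case by (intro exI[of _ "[]"]) auto
next
  case (Suc m)
  from Suc.hyps(2) obtain a where a: "a \<in> A" by fastforce
  from Suc.hyps(2) Suc.prems(3) obtain b where b: "b \<in> B" by fastforce
  let ?s = "s @ [a, b]"
  have ab: "edge E a b" "a \<noteq> b" using Suc.prems a b by auto
  have "\<exists>q. path_in E (?s @ q) \<and> set q = (A - {a}) \<union> (B - {b}) \<and>
      (A - {a} \<noteq> {} \<longrightarrow> last (?s @ q) \<in> B - {b})"
  proof (rule Suc.hyps(1))
    show "m = card (A - {a})" using Suc.hyps(2) a Suc.prems(1) by simp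
    show "card (A - {a}) = card (B - {b})" using Suc.prems a b by simp
    show "path_in E ?s"
      using Suc.prems a b ab by (auto simp: path_in_append path_in_Cons)
    show "set ?s \<inter> (A - {a} \<union> (B - {b})) = {}"
      using Suc.prems a b by auto
    show "edge E (last ?s) a'" if "a' \<in> A - {a}" for a'
      using Suc.prems(8)[of a' b] that b by (simp add: edge_commute)
  qed (use Suc.prems in auto)
  then obtain q where q: "path_in E (?s @ q)" "set q = (A - {a}) \<union> (B - {b})"
      "A - {a} \<noteq> {} \<longrightarrow> last (?s @ q) \<in> B - {b}" by blast
  have "last (?s @ q) \<in> B"
  proof (cases "A - {a} = {}")
    \<comment> \<open>The induction hypothesis is silent about the last vertex when nothing of
      \<open>A\<close> remains; then \<open>q = []\<close> and the path ends in
      \<open>b\<close>.\<close>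
    case True
    have "card (B - {b}) = card (A - {a})" using Suc.prems(1-3) a b by simp
    then have "card (B - {b}) = 0" unfolding True by simp
    then have B: "B - {b} = {}" using Suc.prems(2) by simp
    have "q = []" using q(2) unfolding True B by simp
    then show ?thesis using b by simp
  next
    case False
    then show ?thesis using q(3) by blast
  qed
  moreover have "set ([a, b] @ q) = A \<union> B" using q(2) a b by auto
  moreover have "path_in E (s @ [a, b] @ q)" using q(1) by simp
  ultimately show ?case by (metis append_assoc)
qed

section \<open>Balanced bipartite graphs without a spanning path\<close>

locale balanced_bip =
  fixes X Y :: "'a set" and E :: "('a \<times> 'a) set" and n :: nat
  assumes finite_X: "finite X" and finite_Y: "finite Y"
    and disjoint: "X \<inter> Y = {}"
    and E_sub: "E \<subseteq> X \<times> Y"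
    and card_X: "card X = n" and card_Y: "card Y = n"
begin

text \<open>Interpreting the locale with the parts exchanged turns each statement about
  \<open>X\<close> into one about \<open>Y\<close>.\<close>

lemma swapped: "balanced_bip Y X (E\<inverse>) n"
  using finite_X finite_Y disjoint E_sub card_X card_Y by unfold_locales auto

lemma finite_E: "finite E"
  using finite_subset[OF E_sub] finite_X finite_Y by simp

lemma nb_sub: "E `` {x} \<subseteq> Y" "E\<inverse> `` {y} \<subseteq> X"
  using E_sub by auto

lemma finite_nb [simp]: "finite (E `` A)" "finite (E\<inverse> `` A)"
  using finite_E by (simp_all add: finite_Image)

lemma edge_Y: "y \<in> Y \<Longrightarrow> edge E y x \<longleftrightarrow> (x, y) \<in> E"
  using E_sub disjoint by (auto simp: edge_def)

text \<open>Mapping each neighbour of \<open>x\<close> to its successor on the path is an injection into the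
  non-neighbours of \<open>y\<close>.\<close>

lemma degree_sum_le:
  assumes ns: "\<not> spannable (X \<union> Y) E"
    and xy: "x \<in> X" "y \<in> Y" "(x, y) \<notin> E"
    and sp: "spannable (X \<union> Y) (insert (x, y) E)"
  shows "card (E `` {x}) + card (E\<inverse> `` {y}) \<le> n"
proof -
  obtain p0 where p0: "path_in (insert (x, y) E) p0" "set p0 = X \<union> Y"
    using sp by (auto simp: spannable_def)
  then have "\<not> path_in E p0" using ns by (auto simp: spannable_def)
  then obtain us vs where uv: "p0 = us @ vs \<or> rev p0 = us @ vs" "us \<noteq> []" "vs \<noteq> []"
      "last us = x" "hd vs = y"
    using path_in_insert_split[OF p0(1)] by metis
  define p where "p = us @ vs"
  have p: "path_in (insert (x, y) E) p" "set p = X \<union> Y"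
    using uv(1) p0 unfolding p_def by (metis path_in_rev set_rev)+
  have dp: "distinct p" using p by (simp add: path_in_def)
  have xu: "x \<in> set us" "y \<in> set vs" using uv by auto
  have us: "path_in E us"
    by (rule path_in_insert_avoid[of x y]) (use p dp xu in \<open>auto simp: p_def path_in_append\<close>)
  have vs: "path_in E vs"
    by (rule path_in_insert_avoid[of x y]) (use p dp xu in \<open>auto simp: p_def path_in_append\<close>)
  have disj: "set us \<inter> set vs = {}" using dp by (simp add: p_def)
  have V: "set us \<union> set vs = X \<union> Y" using p(2) by (simp add: p_def)
  have nsE: False if "path_in E q" "set q = X \<union> Y" for q
    using ns that by (auto simp: spannable_def)
  have succ: "b \<noteq> [] \<and> hd b \<in> X - E\<inverse> `` {y}" if u: "(x, u) \<in> E" and pab: "p = a @ u # b" for u a b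
  proof -
    have uY: "u \<in> Y" "u \<noteq> x" "u \<noteq> y" using u E_sub xy disjoint by auto
    have exu: "edge E x u" "edge E u x" using u by (auto simp: edge_def)
    from pab have "us @ vs = a @ u # b" by (simp add: p_def)
    then consider b' where "us = a @ u # b'" "b = b' @ vs" | "us = a" "vs = u # b"
        | zs where "vs = zs @ u # b" "a = us @ zs"
      by (auto simp: append_eq_append_conv2 Cons_eq_append_conv append_eq_Cons_conv)
    then show ?thesis
    proof cases
      case 1
      have b': "b' \<noteq> []" using 1 uv(4) uY by auto
      have lb: "last b' = x" using 1 b' uv(4) by simp
      have "edge E u (hd b')" using us b' 1 by (auto simp: path_in_append path_in_Cons)
      then have c: "hd b' \<in> X" using uY E_sub disjoint by (auto simp: edge_def)
      \<comment> \<open>From \<open>u\<close> jump to \<open>x\<close>, run back along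
        \<open>us\<close> to the successor of \<open>u\<close>, and cross from there to
        \<open>y\<close>: a spanning path without the new edge.\<close>
      have False if "(hd b', y) \<in> E"
      proof (rule nsE)
        have "edge E (hd b') y" using that by (simp add: edge_def)
        then show "path_in E (a @ [u] @ rev b' @ vs)"
          using us vs b' lb exu uv(3,5) disj 1
          by (auto simp: path_in_append path_in_Cons hd_rev last_rev hd_append)
        show "set (a @ [u] @ rev b' @ vs) = X \<union> Y" using V 1 by auto
      qed
      then show ?thesis using b' c 1 by auto
    next
      case 2
      then show ?thesis using uv(5) uY by simp
    next
      case 3
      have hz: "zs \<noteq> []" using 3 uv(5) uY by (cases zs) auto
      have hzy: "hd zs = y" using 3 uv(5) hz by simp
      \<comment> \<open>If \<open>u\<close> ended the path, \<open>us\<close> followed by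
        \<open>vs\<close> backwards would be a spanning path, through the edge from \<open>x\<close>
        to \<open>u\<close>.\<close>
      have b: "b \<noteq> []"
      proof
        assume "b = []"
        show False
        proof (rule nsE)
          have "path_in E (rev vs)" using vs by simp
          moreover have "hd (rev vs) = u" using 3 \<open>b = []\<close> by simp
          ultimately show "path_in E (us @ rev vs)"
            using us exu uv(4) disj by (simp add: path_in_append)
          show "set (us @ rev vs) = X \<union> Y" using V by simp
        qed
      qed
      have "edge E u (hd b)" using vs b 3 by (auto simp: path_in_append path_in_Cons)
      then have c: "hd b \<in> X" using uY E_sub disjoint by (auto simp: edge_def)
      \<comment> \<open>The mirror image: jump from \<open>x\<close> to \<open>u\<close>, run back
        along \<open>vs\<close> to \<open>y\<close>, and cross from there to the successor of
        \<open>u\<close>.\<close>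
      have False if "(hd b, y) \<in> E"
      proof (rule nsE)
        have "edge E y (hd b)" using that by (simp add: edge_def)
        then show "path_in E (us @ (u # rev zs) @ b)"
          using us vs b hz hzy exu uv(2,4) disj 3
          by (auto simp: path_in_append path_in_Cons hd_rev last_rev edge_commute)
        show "set (us @ (u # rev zs) @ b) = X \<union> Y" using V 3 by auto
      qed
      then show ?thesis using b c by auto
    qed
  qed
  have "\<forall>u\<in>E `` {x}. \<exists>i. i < length p \<and> p ! i = u"
    using p(2) E_sub by (metis Image_singleton_iff SigmaD2 UnCI in_set_conv_nth subsetD)
  then obtain idx where idx: "\<And>u. (x, u) \<in> E \<Longrightarrow> idx u < length p \<and> p ! idx u = u"
    by (metis Image_singleton_iff)
  have ok: "Suc (idx u) < length p \<and> p ! Suc (idx u) \<in> X - E\<inverse> `` {y}" if u: "(x, u) \<in> E" for u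
  proof -
    have "p = take (idx u) p @ u # drop (Suc (idx u)) p"
      using idx[OF u] id_take_nth_drop by metis
    from succ[OF u this] show ?thesis by (auto simp: hd_drop_conv_nth)
  qed
  have "card (E `` {x}) \<le> card (X - E\<inverse> `` {y})"
  proof (rule card_inj_on_le[where f = "\<lambda>u. p ! Suc (idx u)"])
    show "inj_on (\<lambda>u. p ! Suc (idx u)) (E `` {x})"
    proof (rule inj_onI)
      fix u v assume "u \<in> E `` {x}" "v \<in> E `` {x}" "p ! Suc (idx u) = p ! Suc (idx v)"
      then have "idx u = idx v" using ok dp by (simp add: nth_eq_iff_index_eq)
      then show "u = v" using idx \<open>u \<in> E `` {x}\<close> \<open>v \<in> E `` {x}\<close> by (metis Image_singleton_iff)
    qed
  qed (use ok finite_X in auto)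
  also have "\<dots> = n - card (E\<inverse> `` {y})"
    using nb_sub(2)[of y] card_X by (simp add: card_Diff_subset)
  also have "card (E\<inverse> `` {y}) \<le> n"
    using card_mono[OF finite_X nb_sub(2)] card_X by simp
  ultimately show ?thesis by simp
qed

text \<open>For an inclusion-maximal \<open>H\<close> without spanning path, adding any missing pair
  creates one, so \<open>degree_sum_le\<close> applies to every missing pair.\<close>

lemma obtain_closure:
  assumes "\<not> spannable (X \<union> Y) E"
  obtains H where "E \<subseteq> H" "H \<subseteq> X \<times> Y" "\<not> spannable (X \<union> Y) H"
    "\<And>x y. x \<in> X \<Longrightarrow> y \<in> Y \<Longrightarrow> (x, y) \<notin> H \<Longrightarrow> card (H `` {x}) + card (H\<inverse> `` {y}) \<le> n"
proof -
  let ?S = "{H. H \<subseteq> X \<times> Y \<and> \<not> spannable (X \<union> Y) H}"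
  have "finite ?S" using finite_X finite_Y by simp
  moreover have "E \<in> ?S" using assms E_sub by simp
  ultimately obtain H where H: "H \<in> ?S" "E \<subseteq> H" "\<forall>H'\<in>?S. H \<subseteq> H' \<longrightarrow> H = H'"
    using finite_has_maximal2[of ?S E] by blast
  interpret H: balanced_bip X Y H n
    using finite_X finite_Y disjoint card_X card_Y H(1) by unfold_locales auto
  show thesis
  proof (rule that[of H])
    fix x y assume xy: "x \<in> X" "y \<in> Y" "(x, y) \<notin> H"
    have "insert (x, y) H \<notin> ?S" using H(3) xy by blast
    then have "spannable (X \<union> Y) (insert (x, y) H)" using H(1) xy by auto
    then show "card (H `` {x}) + card (H\<inverse> `` {y}) \<le> n"
      using H.degree_sum_le xy H(1) by blast
  qed (use H in auto)
qed

text \<open>The path starts with some \<open>a\<close> and the prescribed \<open>b\<close> before it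
  zigzags on, so it ends in \<open>b\<close> only if \<open>A\<close> is a singleton. This keeps the
  end away from a vertex that may lack edges to the rest of the graph.\<close>

lemma complete_zigzag:
  assumes "A \<subseteq> X" "B \<subseteq> Y" "A \<noteq> {}" "card A = card B" "A \<times> B \<subseteq> E" "b \<in> B"
  obtains s where "path_in E s" "s \<noteq> []" "set s = A \<union> B" "last s \<in> B"
    "card A \<noteq> 1 \<Longrightarrow> last s \<noteq> b"
proof -
  have fin: "finite A" "finite B"
    using assms finite_X finite_Y finite_subset by blast+
  have AB: "A \<inter> B = {}" using assms disjoint by blast
  obtain a where a: "a \<in> A" using assms by blast
  have ab: "a \<notin> B" "b \<notin> A" using AB a assms by auto
  have "\<exists>q. path_in E ([a, b] @ q) \<and> set q = (A - {a}) \<union> (B - {b}) \<and>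
      (A - {a} \<noteq> {} \<longrightarrow> last ([a, b] @ q) \<in> B - {b})"
  proof (rule extend_path_zigzag)
    show "card (A - {a}) = card (B - {b})" using assms a fin by simp
    show "path_in E [a, b]"
      using assms a disjoint by (auto simp: path_in_Cons edge_def)
  qed (use assms(5,6) fin AB ab in \<open>auto simp: edge_def\<close>)
  then obtain q where q: "path_in E ([a, b] @ q)" "set q = (A - {a}) \<union> (B - {b})"
      "A - {a} \<noteq> {} \<longrightarrow> last ([a, b] @ q) \<in> B - {b}" by blast
  have l: "last ([a, b] @ q) \<in> B \<and> (card A \<noteq> 1 \<longrightarrow> last ([a, b] @ q) \<noteq> b)"
  proof (cases "A - {a} = {}")
    case True
    then have A: "A = {a}" using a by blast
    then have "card (B - {b}) = 0" using assms fin by simp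
    then have B: "B - {b} = {}" using fin by simp
    have "q = []" using q(2) unfolding True B by simp
    then show ?thesis using assms A by simp
  next
    case False
    then show ?thesis using q(3) by blast
  qed
  show thesis
    by (rule that[of "[a, b] @ q"]) (use q(1,2) l a assms in auto)
qed

end

section \<open>Closed graphs: configurations that force a spanning path\<close>

locale closed_bip = balanced_bip +
  assumes not_spannable: "\<not> spannable (X \<union> Y) E"
    and closed: "x \<in> X \<Longrightarrow> y \<in> Y \<Longrightarrow> (x, y) \<notin> E \<Longrightarrow> card (E `` {x}) + card (E\<inverse> `` {y}) \<le> n"
begin

lemma swapped_closed: "closed_bip Y X (E\<inverse>) n"
proof -
  interpret S: balanced_bip Y X "E\<inverse>" n by (rule swapped)
  show ?thesis
    by unfold_locales (use not_spannable closed in \<open>auto simp: Un_commute add.commute\<close>)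
qed

text \<open>The common source of contradictions: a balanced path whose end sees all remaining
  vertices of \<open>X\<close> zigzags through the complete remainder and becomes spanning.\<close>

lemma no_completion:
  assumes "path_in E s" "s \<noteq> []" "set s = A \<union> B" "A \<subseteq> X" "B \<subseteq> Y" "card A = card B"
    and "\<And>x. x \<in> X - A \<Longrightarrow> edge E (last s) x"
    and "\<And>x y. x \<in> X - A \<Longrightarrow> y \<in> Y - B \<Longrightarrow> (x, y) \<in> E"
  shows False
proof -
  have fin: "finite A" "finite B"
    using assms finite_X finite_Y finite_subset by blast+
  have "\<exists>q. path_in E (s @ q) \<and> set q = (X - A) \<union> (Y - B) \<and>
      (X - A \<noteq> {} \<longrightarrow> last (s @ q) \<in> Y - B)"
  proof (rule extend_path_zigzag)
    show "card (X - A) = card (Y - B)"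
      using assms fin card_X card_Y by (simp add: card_Diff_subset)
    show "edge E a b" if "a \<in> X - A" "b \<in> Y - B" for a b
      using assms(8)[OF that] by (simp add: edge_def)
  qed (use assms finite_X finite_Y disjoint in auto)
  then obtain q where "path_in E (s @ q)" "set q = (X - A) \<union> (Y - B)" by blast
  moreover have "set (s @ q) = X \<union> Y"
    using assms(3,4,5) calculation(2) by auto
  ultimately show False using not_spannable unfolding spannable_def by blast
qed

text \<open>The known neighbours of \<open>y\<close> are all of \<open>X - X0\<close> and the set
  \<open>Z\<close> inside \<open>X0\<close>; the count is written additively to avoid truncated
  subtraction.\<close>

lemma degree_ge:
  assumes "(X - X0) \<union> Z \<subseteq> E\<inverse> `` {y}" "X0 \<subseteq> X" "Z \<subseteq> X0"
  shows "n + card Z \<le> card (E\<inverse> `` {y}) + card X0"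
proof -
  have fin: "finite X0" "finite Z"
    using assms finite_X finite_subset by (metis)+
  have "card ((X - X0) \<union> Z) = card (X - X0) + card Z"
    using fin finite_X assms by (intro card_Un_disjoint) auto
  also have "card (X - X0) = n - card X0"
    using fin assms card_X by (simp add: card_Diff_subset)
  finally have "n - card X0 + card Z \<le> card (E\<inverse> `` {y})"
    using card_mono[OF _ assms(1)] by simp
  moreover have "card X0 \<le> n" using card_mono[OF finite_X assms(2)] card_X by simp
  ultimately show ?thesis by simp
qed

text \<open>A neighbour \<open>y\<close> of one vertex of \<open>X0\<close> has degree at least
  \<open>n - card X0 + 1\<close>, so closedness joins it to all of \<open>X0\<close>. Hence
  \<open>X0\<close> is complete to \<open>card X0\<close> vertices of \<open>Y\<close>; a path
  through these extends over the complete rest.\<close>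

lemma large_degrees_impossible:
  assumes "X0 \<subseteq> X" "X0 \<noteq> {}"
    and deg: "\<And>x. x \<in> X0 \<Longrightarrow> card X0 \<le> card (E `` {x})"
    and full: "\<And>x y. x \<in> X - X0 \<Longrightarrow> y \<in> Y \<Longrightarrow> (x, y) \<in> E"
  shows False
proof -
  have fin: "finite X0" using assms finite_X finite_subset by blast
  have all: "(x, y) \<in> E" if "x \<in> X0" "x' \<in> X0" "(x', y) \<in> E" for x x' y
  proof (rule ccontr)
    assume no: "(x, y) \<notin> E"
    have y: "y \<in> Y" using that E_sub by auto
    have "card (E `` {x}) + card (E\<inverse> `` {y}) \<le> n"
      using closed no y that assms by blast
    moreover have "n + card {x'} \<le> card (E\<inverse> `` {y}) + card X0"
      using full y that assms by (intro degree_ge) auto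
    ultimately show False using deg[OF that(1)] by simp
  qed
  obtain x0 where x0: "x0 \<in> X0" using assms by blast
  obtain F where F: "F \<subseteq> E `` {x0}" "card F = card X0"
    using obtain_subset_with_card_n[OF deg[OF x0]] by metis
  have "F \<noteq> {}" using F x0 fin by (metis card.empty card_0_eq empty_iff)
  then obtain b where b: "b \<in> F" by blast
  have FY: "F \<subseteq> Y" using F E_sub by auto
  have "X0 \<times> F \<subseteq> E" using F all x0 by blast
  then obtain s where s: "path_in E s" "s \<noteq> []" "set s = X0 \<union> F" "last s \<in> F"
    using complete_zigzag[of X0 F b] assms F FY b by metis
  show False
    by (rule no_completion[OF s(1-3) assms(1) FY])
      (use F full FY s(4) in \<open>auto simp: edge_Y subset_iff edge_def\<close>)
qed

text \<open>Closedness first joins \<open>x\<close> to every neighbour of \<open>X0\<close>. A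
  neighbour of another vertex of \<open>X0\<close> then has two neighbours in \<open>X0\<close>, and
  closedness joins it to all of \<open>X0\<close>. So \<open>X0\<close> is complete to some
  \<open>k\<close>-set \<open>F\<close>, and one more neighbour \<open>y\<close> of \<open>x\<close>
  balances the numbers.\<close>

lemma almost_large_degrees_impossible:
  assumes "X0 \<subseteq> X" "card X0 = Suc k"
    and deg: "\<And>x. x \<in> X0 \<Longrightarrow> k \<le> card (E `` {x})"
    and x: "x \<in> X0" "Suc k \<le> card (E `` {x})"
    and full: "\<And>x y. x \<in> X - X0 \<Longrightarrow> y \<in> Y \<Longrightarrow> (x, y) \<in> E"
  shows False
proof -
  have fin: "finite X0" using assms finite_X finite_subset by blast
  have nx: "(x, y) \<in> E" if "x' \<in> X0" "(x', y) \<in> E" for x' y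
  proof (rule ccontr)
    assume no: "(x, y) \<notin> E"
    have y: "y \<in> Y" using that E_sub by auto
    have "card (E `` {x}) + card (E\<inverse> `` {y}) \<le> n"
      using closed no y x assms by blast
    moreover have "n + card {x'} \<le> card (E\<inverse> `` {y}) + card X0"
      using full y that assms by (intro degree_ge) auto
    ultimately show False using x assms by simp
  qed
  have all: "(x2, y) \<in> E" if "x1 \<in> X0" "x1 \<noteq> x" "(x1, y) \<in> E" "x2 \<in> X0" for x1 x2 y
  proof (rule ccontr)
    assume no: "(x2, y) \<notin> E"
    have y: "y \<in> Y" using that E_sub by auto
    have "card (E `` {x2}) + card (E\<inverse> `` {y}) \<le> n"
      using closed no y that assms by blast
    moreover have "n + card {x, x1} \<le> card (E\<inverse> `` {y}) + card X0"
      using full y that assms nx by (intro degree_ge) auto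
    ultimately show False using deg[OF that(4)] assms that by simp
  qed
  have "\<exists>F. F \<subseteq> E `` {x} \<and> card F = k \<and> (X0 - {x}) \<times> F \<subseteq> E"
  proof (cases "X0 - {x} = {}")
    case True
    then have "k = 0" using assms fin x by (metis Suc_inject card.empty card_Suc_Diff1)
    then show ?thesis by (intro exI[of _ "{}"]) auto
  next
    case False
    then obtain x1 where x1: "x1 \<in> X0" "x1 \<noteq> x" by blast
    obtain F where F: "F \<subseteq> E `` {x1}" "card F = k"
      using obtain_subset_with_card_n[OF deg[OF x1(1)]] by metis
    then have "F \<subseteq> E `` {x}" "(X0 - {x}) \<times> F \<subseteq> E"
      using nx all x1 by blast+
    then show ?thesis using F by blast
  qed
  then obtain F where F: "F \<subseteq> E `` {x}" "card F = k" "(X0 - {x}) \<times> F \<subseteq> E" by blast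
  have fF: "finite F" by (rule finite_subset[OF F(1)]) simp
  have "\<not> E `` {x} \<subseteq> F"
    using x(2) F(2) card_mono[OF fF, of "E `` {x}"] by auto
  then obtain y where y: "(x, y) \<in> E" "y \<notin> F" by blast
  have FY: "F \<subseteq> Y" "y \<in> Y" using F y E_sub by auto
  have dis: "F \<inter> (X0 - {x}) = {}" "x \<notin> F" "y \<notin> X0" "x \<noteq> y"
    using FY assms(1) x(1) disjoint by blast+
  have "\<exists>q. path_in E ([y, x] @ q) \<and> set q = F \<union> (X0 - {x}) \<and>
      (F \<noteq> {} \<longrightarrow> last ([y, x] @ q) \<in> X0 - {x})"
  proof (rule extend_path_zigzag)
    show "card F = card (X0 - {x})" using assms F x fin by simp
    show "path_in E [y, x]"
      using y FY assms(1) x(1) disjoint by (auto simp: path_in_Cons edge_def)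
    show "edge E a b" if "a \<in> F" "b \<in> X0 - {x}" for a b
      using F(3) that by (auto simp: edge_def)
    show "edge E (last [y, x]) a" if "a \<in> F" for a
      using F(1) that by (auto simp: edge_def)
    show "set [y, x] \<inter> (F \<union> (X0 - {x})) = {}" using dis y(2) by auto
  qed (use fF fin dis in simp_all)
  then obtain q where q: "path_in E ([y, x] @ q)" "set q = F \<union> (X0 - {x})" by blast
  \<comment> \<open>The zigzag from \<open>y\<close>, \<open>x\<close> through \<open>F\<close> ends
    in \<open>X0\<close>. Reversed, it ends in \<open>y\<close>, which is adjacent to all of
    \<open>X - X0\<close>.\<close>
  show False
  proof (rule no_completion[of "rev ([y, x] @ q)" X0 "insert y F"])
    show "path_in E (rev ([y, x] @ q))" using q(1) path_in_rev by blast
    show "set (rev ([y, x] @ q)) = X0 \<union> insert y F" using q(2) x by auto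
    show "card X0 = card (insert y F)" using assms F y fF by simp
    show "edge E (last (rev ([y, x] @ q))) a" if "a \<in> X - X0" for a
      using full[OF that FY(2)] by (simp add: edge_def)
  qed (use assms FY full in auto)
qed

text \<open>Every neighbour of \<open>X0\<close> other than \<open>y1\<close> is joined to all of
  \<open>X0\<close>. By equality of the degrees, \<open>X0\<close> is complete to a
  \<open>k\<close>-set that either avoids or contains \<open>y1\<close>. A spanning path can be
  routed through the defective column \<open>y1\<close> in every case but that of an isolated
  edge.\<close>

lemma deficient_column:
  assumes "X0 \<subseteq> X" "card X0 = k" "1 \<le> k" "k < n"
    and deg: "\<And>x. x \<in> X0 \<Longrightarrow> card (E `` {x}) = k"
    and y1: "y1 \<in> Y" "k \<le> card (E\<inverse> `` {y1})"
    and full: "\<And>x y. x \<in> X - X0 \<Longrightarrow> y \<in> Y - {y1} \<Longrightarrow> (x, y) \<in> E"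
  shows "k = 1 \<and> (\<exists>x\<in>X. \<exists>y\<in>Y. E `` {x} = {y} \<and> E\<inverse> `` {y} = {x})"
proof -
  have fin: "finite X0" using assms finite_X finite_subset by blast
  have all: "(x, y) \<in> E" if "x \<in> X0" "x' \<in> X0" "(x', y) \<in> E" "y \<noteq> y1" for x x' y
  proof (rule ccontr)
    assume no: "(x, y) \<notin> E"
    have y: "y \<in> Y" using that E_sub by auto
    have "card (E `` {x}) + card (E\<inverse> `` {y}) \<le> n"
      using closed no y that assms by blast
    moreover have "n + card {x'} \<le> card (E\<inverse> `` {y}) + card X0"
      using full y that assms by (intro degree_ge) auto
    ultimately show False using deg[OF that(1)] assms by simp
  qed
  define F where "F = E `` X0 - {y1}"
  have F: "X0 \<times> F \<subseteq> E" "finite F" "F \<subseteq> Y" "y1 \<notin> F"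
    using all E_sub by (auto simp: F_def)
  have nb: "E `` {x} = F \<or> E `` {x} = insert y1 F" if "x \<in> X0" for x
    using that F(1) unfolding F_def by blast
  obtain x0 where x0: "x0 \<in> X0" using assms by (metis card.empty equals0I not_one_le_zero)
  have X0ne: "X0 \<noteq> {}" using x0 by blast
  show ?thesis
  proof (cases "\<exists>x\<in>X0. (x, y1) \<in> E")
    case False
    then have "E `` {x0} = F" using nb[OF x0] x0 by blast
    then have cF: "card F = k" using deg[OF x0] by simp
    have "E\<inverse> `` {y1} \<noteq> {}" using y1 assms by (metis card.empty not_one_le_zero le_trans)
    then obtain p where p: "(p, y1) \<in> E" by blast
    have pX: "p \<in> X - X0" using p False E_sub by auto
    have "F \<noteq> {}" using cF assms by auto
    then obtain b where b: "b \<in> F" by blast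
    obtain s where s: "path_in E s" "s \<noteq> []" "set s = X0 \<union> F" "last s \<in> F"
      using complete_zigzag[OF assms(1) F(3) X0ne _ F(1) b] cF assms by metis
    have lastF: "edge E (last s) a" if "a \<in> X - X0" for a
      using full[OF that, of "last s"] s(4) F by (auto simp: edge_def)
    \<comment> \<open>\<open>p\<close> and \<open>y1\<close> are kept for the end of the path, since
      only the columns other than \<open>y1\<close> are known to be complete to
      \<open>X - X0\<close>.\<close>
    let ?A = "X - X0 - {p}" and ?B = "Y - F - {y1}"
    have cA: "card ?A = n - k - 1" and cB: "card ?B = n - k - 1"
      using pX assms fin card_X card_Y finite_X finite_Y F cF y1 by (simp_all add: card_Diff_subset)
    have "\<exists>q. path_in E (s @ q) \<and> set q = ?A \<union> ?B \<and> (?A \<noteq> {} \<longrightarrow> last (s @ q) \<in> ?B)"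
    proof (rule extend_path_zigzag)
      show "edge E a b" if "a \<in> ?A" "b \<in> ?B" for a b
        using full[of a b] that by (simp add: edge_def)
    qed (use finite_X finite_Y cA cB disjoint s lastF F assms in auto)
    then obtain q where q: "path_in E (s @ q)" "set q = ?A \<union> ?B" "?A \<noteq> {} \<longrightarrow> last (s @ q) \<in> ?B"
      by blast
    have l: "edge E (last (s @ q)) p"
    proof (cases "?A = {}")
      case True
      have "card ?B = card ?A" by (simp only: cA cB)
      then have "card ?B = 0" unfolding True by simp
      then have B: "?B = {}" using finite_Y by simp
      have "q = []" using q(2) unfolding True B by simp
      then show ?thesis using lastF[OF pX] by simp
    next
      case False
      then have "last (s @ q) \<in> ?B" using q(3) by blast
      then show ?thesis using full[OF pX] by (simp add: edge_def)
    qed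
    have "edge E p y1" using p by (simp add: edge_def)
    moreover have "p \<noteq> y1" "p \<notin> set (s @ q)" "y1 \<notin> set (s @ q)"
      using q(2) s(3) pX y1 disjoint assms(1) F(3,4) by auto
    ultimately have "path_in E ((s @ q) @ [p, y1])"
      using q(1) l unfolding path_in_append[of E "s @ q"] by (simp add: path_in_Cons)
    moreover have "set ((s @ q) @ [p, y1]) = X \<union> Y"
      using q(2) s(3) pX y1 assms(1) F(3) by auto
    ultimately have False using not_spannable unfolding spannable_def by blast
    then show ?thesis ..
  next
    case True
    then obtain x' where x': "x' \<in> X0" "(x', y1) \<in> E" by blast
    then have "E `` {x'} = insert y1 F" using nb[OF x'(1)] F(4) by blast
    then have cI: "card (insert y1 F) = k" using deg[OF x'(1)] by simp
    then have cF: "Suc (card F) = k" using F(2,4) by simp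
    have nbx: "E `` {x} = insert y1 F" if "x \<in> X0" for x
    proof -
      have "E `` {x} \<noteq> F" using deg[OF that] cF by auto
      then show ?thesis using nb[OF that] by blast
    qed
    then have cmp: "X0 \<times> insert y1 F \<subseteq> E" by blast
    have IY: "insert y1 F \<subseteq> Y" using F y1 by simp
    show ?thesis
    proof (cases "k = 1")
      case False
      \<comment> \<open>The path must not end in \<open>y1\<close>, which may miss vertices of
        \<open>X - X0\<close>; choosing \<open>y1\<close> as the prescribed second vertex prevents
        this, as \<open>k \<noteq> 1\<close>.\<close>
      obtain s where s: "path_in E s" "s \<noteq> []" "set s = X0 \<union> insert y1 F"
          "last s \<in> insert y1 F" "last s \<noteq> y1"
        using complete_zigzag[OF assms(1) IY X0ne _ cmp, of y1] cI assms(2) False by (metis insertI1)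
      have False
        by (rule no_completion[OF s(1-3) assms(1) IY])
          (use s(4,5) full F(3) cI assms(2) in \<open>auto simp: edge_def\<close>)
      then show ?thesis ..
    next
      case k1: True
      then have "card X0 = 1" using assms by simp
      then have X0: "X0 = {x0}" using x0 by (metis card_1_singletonE singletonD)
      have F0: "F = {}" using cF k1 F(2) by simp
      have nx0: "E `` {x0} = {y1}" using nbx[OF x0] F0 by simp
      show ?thesis
      proof (cases "E\<inverse> `` {y1} = {x0}")
        case True
        then show ?thesis using k1 nx0 x0 y1 assms(1) by blast
      next
        case False
        then obtain p where p: "(p, y1) \<in> E" "p \<noteq> x0" using nx0 by auto
        have pX: "p \<in> X - X0" using p X0 E_sub by auto
        have "card (Y - {y1}) \<noteq> 0" using assms card_Y y1 finite_Y by simp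
        then obtain y where y: "y \<in> Y" "y \<noteq> y1" by (metis card.empty Diff_iff equals0I singletonI)
        have e: "edge E x0 y1" "edge E y1 p" "edge E p y"
          using nx0 p full[OF pX] y by (auto simp: edge_def)
        have ne: "x0 \<in> X" "p \<in> X" "p \<noteq> x0" "y \<noteq> y1" using pX X0 assms y p by auto
        \<comment> \<open>A second neighbour \<open>p\<close> of \<open>y1\<close> allows the column
          to be passed at the start: \<open>x0\<close>, \<open>y1\<close>, \<open>p\<close>,
          \<open>y\<close> is balanced and \<open>y\<close> sees the rest of
          \<open>X\<close>.\<close>
        have False
        proof (rule no_completion[of "[x0, y1, p, y]" "{x0, p}" "{y1, y}"])
          show "path_in E [x0, y1, p, y]"
            using e ne y y1 disjoint by (auto simp: path_in_Cons)
          show "edge E (last [x0, y1, p, y]) x" if "x \<in> X - {x0, p}" for x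
            using full[of x y] that y X0 by (simp add: edge_def)
        qed (use ne y y1 full X0 in auto)
        then show ?thesis ..
      qed
    qed
  qed
qed

end

section \<open>Counting missing edges\<close>

text \<open>Inclusion-exclusion: rows \<open>A\<close> and columns \<open>B\<close> overlap in at
  most \<open>card A * card B\<close> pairs. With \<open>M\<close> a set of missing pairs, low
  degrees at a few vertices thus force many missing edges.\<close>

lemma card_cross_le:
  assumes "finite M" "finite A" "finite B"
  shows "card (M \<inter> A \<times> UNIV) + card (M \<inter> UNIV \<times> B) \<le> card M + card A * card B"
proof -
  let ?P = "M \<inter> A \<times> UNIV" and ?Q = "M \<inter> UNIV \<times> B"
  have "card ?P + card ?Q = card (?P \<union> ?Q) + card (?P \<inter> ?Q)"
    using assms by (intro card_Un_Int) auto
  also have "card (?P \<union> ?Q) \<le> card M" using assms by (intro card_mono) auto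
  also have "card (?P \<inter> ?Q) \<le> card (A \<times> B)" using assms by (intro card_mono) auto
  finally show ?thesis by (simp add: card_cartesian_product)
qed

lemma card_row: "card (M \<inter> {a} \<times> UNIV) = card (M `` {a})"
proof -
  have "M \<inter> {a} \<times> UNIV = Pair a ` (M `` {a})" by auto
  then show ?thesis by (simp add: card_image inj_on_def)
qed

lemma card_column: "card (M \<inter> UNIV \<times> {b}) = card (M\<inverse> `` {b})"
proof -
  have "M \<inter> UNIV \<times> {b} = (\<lambda>a. (a, b)) ` (M\<inverse> `` {b})" by auto
  then show ?thesis by (simp add: card_image inj_on_def)
qed

lemma card_two_rows:
  assumes "finite M" "a \<noteq> a'"
  shows "card (M \<inter> {a, a'} \<times> UNIV) = card (M `` {a}) + card (M `` {a'})"
proof -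
  have "M \<inter> {a, a'} \<times> UNIV = (M \<inter> {a} \<times> UNIV) \<union> (M \<inter> {a'} \<times> UNIV)" by auto
  then show ?thesis
    using assms by (simp add: card_Un_disjoint card_row[symmetric] disjoint_iff)
qed

lemma card_two_columns:
  assumes "finite M" "b \<noteq> b'"
  shows "card (M \<inter> UNIV \<times> {b, b'}) = card (M\<inverse> `` {b}) + card (M\<inverse> `` {b'})"
proof -
  have "M \<inter> UNIV \<times> {b, b'} = (M \<inter> UNIV \<times> {b}) \<union> (M \<inter> UNIV \<times> {b'})" by auto
  then show ?thesis
    using assms by (simp add: card_Un_disjoint card_column[symmetric] disjoint_iff)
qed

context balanced_bip
begin

lemma degree_le: "card (E `` {x}) \<le> n" "card (E\<inverse> `` {y}) \<le> n"
  using card_mono[OF finite_Y nb_sub(1)] card_mono[OF finite_X nb_sub(2)] card_X card_Y by simp_all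

lemma card_missing: "card (X \<times> Y - E) + card E = n * n"
  using card_Diff_subset[OF finite_E E_sub] card_mono[OF _ E_sub] finite_X finite_Y card_X card_Y
  by (simp add: card_cartesian_product)

lemma card_missing_split:
  assumes "X0 \<subseteq> X"
  shows "card (X \<times> Y - E) = card ((X - X0) \<times> Y - E) + (\<Sum>x\<in>X0. n - card (E `` {x}))"
proof -
  have fin: "finite X0" using assms finite_X finite_subset by blast
  have "X \<times> Y - E = ((X - X0) \<times> Y - E) \<union> (SIGMA x:X0. Y - E `` {x})"
    using assms by auto
  also have "card \<dots> = card ((X - X0) \<times> Y - E) + card (SIGMA x:X0. Y - E `` {x})"
    using finite_X finite_Y fin by (intro card_Un_disjoint) auto
  also have "card (SIGMA x:X0. Y - E `` {x}) = (\<Sum>x\<in>X0. card (Y - E `` {x}))"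
    using fin finite_Y by (simp add: card_SigmaI)
  also have "\<dots> = (\<Sum>x\<in>X0. n - card (E `` {x}))"
    using nb_sub card_Y by (simp add: card_Diff_subset)
  finally show ?thesis .
qed

text \<open>The row of \<open>a\<close> lies outside \<open>X0\<close> and is counted exactly; in
  the column of \<open>b\<close> the restriction to \<open>X - X0\<close> hides at most
  \<open>card X0\<close> missing pairs.\<close>

lemma missing_row_column:
  assumes "X0 \<subseteq> X" "(a, b) \<in> (X - X0) \<times> Y - E" (is "_ \<in> ?M")
  shows "n = card (?M `` {a}) + card (E `` {a})"
    and "n \<le> card (?M\<inverse> `` {b}) + card (E\<inverse> `` {b}) + card X0"
proof -
  have fin: "finite X0" using assms finite_X finite_subset by blast
  have "?M `` {a} = Y - E `` {a}" using assms by auto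
  then show "n = card (?M `` {a}) + card (E `` {a})"
    using nb_sub(1)[of a] card_Y degree_le by (simp add: card_Diff_subset)
  have "?M\<inverse> `` {b} = (X - X0) - E\<inverse> `` {b}" using assms by auto
  then show "n \<le> card (?M\<inverse> `` {b}) + card (E\<inverse> `` {b}) + card X0"
    using diff_card_le_card_Diff[of "E\<inverse> `` {b}" "X - X0"] card_Diff_subset[OF fin assms(1)] card_X
    by simp
qed

end

section \<open>Few missing edges force vertices of low degree\<close>

context closed_bip
begin

text \<open>Row and column together miss \<open>2 * n\<close> minus the degree sum, up to the part
  hidden by \<open>X0\<close>, and the degree sum of a missing pair is at most
  \<open>n\<close>.\<close>

lemma missing_cross_ge:
  assumes "X0 \<subseteq> X" "(a, b) \<in> (X - X0) \<times> Y - E" (is "_ \<in> ?M")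
  shows "n \<le> card (?M `` {a}) + card (?M\<inverse> `` {b}) + card X0"
  using missing_row_column[OF assms] closed[of a b] assms by auto

text \<open>The rows of \<open>X0\<close> use up all but \<open>Suc k * Suc k\<close> of the
  permitted missing edges. A missing pair outside \<open>X0\<close> would need more than that, so
  \<open>X - X0\<close> is complete to \<open>Y\<close>, and a vertex of degree \<open>k + 1\<close>
  in \<open>X0\<close> is impossible by \<open>almost_large_degrees_impossible\<close>.\<close>

lemma low_vertices_degree:
  assumes n: "(k + 2)\<^sup>2 \<le> n" and e: "n * n \<le> card E + n * (k + 1)"
    and deg: "\<And>x. x \<in> X \<Longrightarrow> k \<le> card (E `` {x})"
    and X0: "X0 \<subseteq> X" "card X0 = Suc k" "\<And>x. x \<in> X0 \<Longrightarrow> card (E `` {x}) \<le> Suc k"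
    and x: "x \<in> X0"
  shows "card (E `` {x}) \<le> k"
proof (rule ccontr)
  assume gt: "\<not> card (E `` {x}) \<le> k"
  let ?M = "(X - X0) \<times> Y - E"
  have "(\<Sum>x\<in>X0. n - Suc k) \<le> (\<Sum>x\<in>X0. n - card (E `` {x}))"
    using X0 by (intro sum_mono) (auto intro: diff_le_mono2)
  then have "card ?M + Suc k * (n - Suc k) \<le> n * (k + 1)"
    using card_missing card_missing_split[OF X0(1)] X0(2) e by simp
  moreover have "Suc k * (n - Suc k) + Suc k * Suc k = n * (k + 1)"
  proof -
    have "Suc k \<le> n" using n by (simp add: power2_eq_square)
    then show ?thesis by (metis Suc_eq_plus1 add_mult_distrib2 le_add_diff_inverse2 mult.commute)
  qed
  ultimately have M: "card ?M \<le> Suc k * Suc k" by linarith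
  have "?M = {}"
  proof (rule ccontr)
    assume "?M \<noteq> {}"
    then obtain a b where ab: "(a, b) \<in> ?M" by auto
    \<comment> \<open>The \<open>1\<close> accounts for the pair \<open>(a, b)\<close>, which lies
      in its row and in its column.\<close>
    have "card (?M `` {a}) + card (?M\<inverse> `` {b}) \<le> card ?M + 1"
      using card_cross_le[of ?M "{a}" "{b}"] finite_X finite_Y card_row[of ?M a] card_column[of ?M b]
      by simp
    then have "n \<le> Suc k * Suc k + 1 + Suc k"
      using missing_cross_ge[OF X0(1) ab] M X0(2) by linarith
    then show False using n by (simp add: power2_eq_square)
  qed
  then show False
    using almost_large_degrees_impossible[OF X0(1,2) _ x] deg X0(1) gt by fastforce
qed

text \<open>The set \<open>N\<close> of non-neighbours of \<open>y\<close> has at least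
  \<open>s\<close> elements, all of degree at most \<open>s\<close> by maximality of the degree sum.
  If \<open>s \<ge> k + 2\<close>, then \<open>s\<close> of them exhaust the permitted missing
  edges. If \<open>s = k + 1\<close>, \<open>low_vertices_degree\<close> is contradicted. If
  \<open>s = k\<close>, either \<open>N\<close> has \<open>k + 1\<close> elements, or the missing
  pairs outside \<open>N\<close> lie in one row or one column.\<close>

lemma low_degree_structure_oriented:
  assumes n: "(k + 2)\<^sup>2 \<le> n" and e: "n * n \<le> card E + n * (k + 1)"
    and degX: "\<And>x. x \<in> X \<Longrightarrow> k \<le> card (E `` {x})"
    and degY: "\<And>y. y \<in> Y \<Longrightarrow> k \<le> card (E\<inverse> `` {y})"
    and x: "x \<in> X" and y: "y \<in> Y" and xy: "(x, y) \<notin> E"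
    and maximal: "\<And>x' y'. x' \<in> X \<Longrightarrow> y' \<in> Y \<Longrightarrow> (x', y') \<notin> E \<Longrightarrow>
        card (E `` {x'}) + card (E\<inverse> `` {y'}) \<le> card (E `` {x}) + card (E\<inverse> `` {y})"
    and le: "card (E `` {x}) \<le> card (E\<inverse> `` {y})"
  shows "(\<exists>X0\<subseteq>X. card X0 = Suc k \<and> (\<forall>x\<in>X0. card (E `` {x}) \<le> k)) \<or>
    (k = 1 \<and> (\<exists>x\<in>X. \<exists>y\<in>Y. E `` {x} = {y} \<and> E\<inverse> `` {y} = {x}))"
proof -
  define s where "s = card (E `` {x})"
  define t where "t = card (E\<inverse> `` {y})"
  define N where "N = X - E\<inverse> `` {y}"
  have st: "s + t \<le> n" "s \<le> t" using closed[OF x y xy] le by (auto simp: s_def t_def)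
  have cN: "card N = n - t"
    using nb_sub(2)[of y] card_X by (simp add: N_def t_def card_Diff_subset)
  then have sN: "s \<le> card N" using st by simp
  have xN: "x \<in> N" and NX: "N \<subseteq> X" using x xy by (auto simp: N_def)
  have fN: "finite N" using finite_X by (simp add: N_def)
  have dN: "card (E `` {x'}) \<le> s" if "x' \<in> N" for x'
    using maximal[of x' y] that y by (auto simp: N_def s_def)
  have ks: "k \<le> s" using degX x by (simp add: s_def)
  have kn: "k < n" using n by (simp add: power2_eq_square)
  consider "k + 2 \<le> s" | "s = k + 1" | "s = k" using ks by linarith
  then show ?thesis
  proof cases
    case 1
    obtain X0 where X0: "X0 \<subseteq> N" "card X0 = s" using obtain_subset_with_card_n[OF sN] by metis
    then have X0X: "X0 \<subseteq> X" using NX by blast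
    have fin: "finite X0" using X0X finite_X finite_subset by blast
    let ?M = "(X - X0) \<times> Y - E"
    \<comment> \<open>Writing both \<open>s\<close> and \<open>n - s\<close> as \<open>c\<close>
      plus a remainder, \<open>c * n - s * (n - s)\<close> equals \<open>c * c - i * j\<close>,
      which is at most \<open>n\<close>.\<close>
    define c where "c = k + 2"
    obtain i where i: "s = c + i" using 1 unfolding c_def by (metis le_iff_add)
    obtain j where j: "n - s = c + j"
    proof -
      have "c \<le> n - s" using 1 st unfolding c_def by simp
      then show ?thesis using that by (metis le_iff_add)
    qed
    have ns: "n = (c + i) + (c + j)" using i j st by linarith
    have "c * c \<le> n" using n by (simp add: c_def power2_eq_square)
    then have "c * n \<le> s * (n - s) + n"
      unfolding i j[unfolded i] by (subst (1) ns) (simp add: algebra_simps)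
    moreover have "c * n = n * (k + 1) + n" by (simp add: c_def algebra_simps)
    ultimately have big: "n * (k + 1) \<le> s * (n - s)" by linarith
    have miss: "card ?M + (\<Sum>x\<in>X0. n - card (E `` {x})) \<le> n * (k + 1)"
      using card_missing card_missing_split[OF X0X] e by simp
    have each: "n - s \<le> n - card (E `` {x'})" if "x' \<in> X0" for x'
      using dN X0 that by (intro diff_le_mono2) auto
    then have sum: "s * (n - s) \<le> (\<Sum>x\<in>X0. n - card (E `` {x}))"
      using sum_mono[of X0 "\<lambda>_. n - s" "\<lambda>x. n - card (E `` {x})"] X0(2) by simp
    then have "card ?M = 0" using miss big by linarith
    then have M: "?M = {}" using finite_X finite_Y by simp
    \<comment> \<open>The permitted missing edges are used up exactly by degree \<open>s\<close>
      throughout \<open>X0\<close>; a smaller degree would exceed them.\<close>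
    have "card X0 \<le> card (E `` {x'})" if "x' \<in> X0" for x'
    proof (rule ccontr)
      assume "\<not> card X0 \<le> card (E `` {x'})"
      then have "n - s < n - card (E `` {x'})" using X0 st by simp
      then have "(\<Sum>x\<in>X0. n - s) < (\<Sum>x\<in>X0. n - card (E `` {x}))"
        using each that fin by (intro sum_strict_mono_ex1) auto
      then show False using X0 miss big by simp
    qed
    moreover have "X0 \<noteq> {}" using X0 1 by auto
    ultimately have False
      using large_degrees_impossible[OF X0X] M by blast
    then show ?thesis ..
  next
    case 2
    \<comment> \<open>The set is chosen to contain \<open>x\<close> itself, whose degree
      \<open>k + 1\<close> violates the bound \<open>k\<close> obtained for its members.\<close>
    have "k \<le> card (N - {x})" using sN 2 xN fN by simp
    then obtain Z where Z: "Z \<subseteq> N - {x}" "card Z = k"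
      using obtain_subset_with_card_n by metis
    have fZ: "finite Z" using Z(1) fN finite_subset by blast
    have "card (E `` {x}) \<le> k"
    proof (rule low_vertices_degree[OF n e degX])
      show "insert x Z \<subseteq> X" using Z NX xN by blast
      show "card (insert x Z) = Suc k" using Z fZ by (subst card_insert_disjoint) auto
      show "card (E `` {x'}) \<le> Suc k" if "x' \<in> insert x Z" for x'
        using dN[of x'] that Z xN 2 by auto
    qed auto
    then show ?thesis using 2 by (simp add: s_def)
  next
    case 3
    show ?thesis
    proof (cases "Suc k \<le> card N")
      case True
      then obtain X0 where X0: "X0 \<subseteq> N" "card X0 = Suc k"
        using obtain_subset_with_card_n by metis
      then show ?thesis using dN 3 NX by blast
    next
      case False
      then have cNk: "card N = k" using sN 3 by simp
      then have k1: "1 \<le> k" using xN fN by (metis One_nat_def Suc_leI card_gt_0_iff empty_iff)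
      let ?M = "(X - N) \<times> Y - E"
      have fM: "finite ?M" using finite_X finite_Y by simp
      have dNk: "card (E `` {x'}) = k" if "x' \<in> N" for x'
        using dN[OF that] degX[of x'] NX that 3 by auto
      have "card ?M + k * (n - k) \<le> n * (k + 1)"
        using card_missing card_missing_split[OF NX] e dNk cNk by simp
      moreover have "k * (n - k) + k * k = n * k"
        using kn by (metis add_mult_distrib2 le_add_diff_inverse2 less_imp_le mult.commute)
      ultimately have M: "card ?M \<le> n + k * k" by (simp add: algebra_simps)
      have nk: "n \<ge> k * k + 4 * k + 4" using n by (simp add: power2_eq_square algebra_simps)
      \<comment> \<open>Two missing pairs in different rows and columns would force at least
        \<open>2 * (n - k) - 4\<close> missing pairs outside \<open>N\<close>, more than the
        \<open>n + k * k\<close> that are left. Pairs that pairwise share a row or a column all lie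
        in one row or all in one column.\<close>
      have share: "a = a' \<or> b = b'" if "(a, b) \<in> ?M" "(a', b') \<in> ?M" for a b a' b'
      proof (rule ccontr)
        assume ne: "\<not> (a = a' \<or> b = b')"
        then have "card {a, a'} = 2" "card {b, b'} = 2" by auto
        then have "card (?M `` {a}) + card (?M `` {a'}) +
            (card (?M\<inverse> `` {b}) + card (?M\<inverse> `` {b'})) \<le> card ?M + 4"
          using card_cross_le[OF fM, of "{a, a'}" "{b, b'}"] card_two_rows[OF fM] card_two_columns[OF fM] ne
          by simp
        then have "2 * n \<le> n + k * k + 4 + 2 * k"
          using missing_cross_ge[OF NX that(1)] missing_cross_ge[OF NX that(2)] M cNk by linarith
        then show False using nk k1 by linarith
      qed
      show ?thesis
      proof (cases "?M = {}")
        case True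
        have False
        proof (rule large_degrees_impossible[OF NX])
          show "(x', y') \<in> E" if "x' \<in> X - N" "y' \<in> Y" for x' y'
            using True that by blast
        qed (use xN dNk cNk in auto)
        then show ?thesis ..
      next
        case False
        then obtain a b where ab: "(a, b) \<in> ?M" by auto
        show ?thesis
        proof (cases "\<forall>(a', b')\<in>?M. a' = a")
          \<comment> \<open>All missing pairs lie in row \<open>a\<close>. The column of
            \<open>b\<close> contributes just one, so closedness leaves \<open>a\<close> at most
            \<open>k + 1\<close> neighbours, and \<open>a\<close> completes \<open>N\<close> to a
            set of \<open>k + 1\<close> low vertices.\<close>
          case True
          then have "?M\<inverse> `` {b} = {a}" using ab by blast
          then have "card (?M\<inverse> `` {b}) = 1" by simp
          then have da: "card (E `` {a}) \<le> Suc k"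
            using missing_row_column(1)[OF NX ab] missing_cross_ge[OF NX ab] cNk by linarith
          have aN: "a \<in> X" "a \<notin> N" using ab by auto
          have I: "insert a N \<subseteq> X" "card (insert a N) = Suc k" using aN NX cNk fN by simp_all
          have d: "card (E `` {x'}) \<le> Suc k" if "x' \<in> insert a N" for x'
            using da dNk that by (cases "x' = a") simp_all
          have "card (E `` {x'}) \<le> k" if "x' \<in> insert a N" for x'
            using low_vertices_degree[OF n e degX I d that] by blast
          then show ?thesis using I by blast
        next
          case False
          \<comment> \<open>With a second row involved, sharing puts all missing pairs into column
            \<open>b\<close>.\<close>
          then obtain a'' b'' where "(a'', b'') \<in> ?M" "a'' \<noteq> a" by blast
          then have "b' = b" if "(a', b') \<in> ?M" for a' b'
            using share[OF ab] share[OF that] that by metis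
          then have "(x', y') \<in> E" if "x' \<in> X - N" "y' \<in> Y - {b}" for x' y'
            using that by blast
          then show ?thesis
            using deficient_column[OF NX cNk k1 kn dNk, of b] ab degY by auto
        qed
      qed
    qed
  qed
qed

text \<open>The oriented statement is applied to a missing pair of maximal degree sum, with the
  parts exchanged if its \<open>X\<close> end has the larger degree. Some pair is missing because
  \<open>large_degrees_impossible\<close> with \<open>X0 = X\<close> rules out the complete
  graph.\<close>

lemma low_degree_structure:
  assumes n: "(k + 2)\<^sup>2 \<le> n" and e: "n * n \<le> card E + n * (k + 1)"
    and degX: "\<And>x. x \<in> X \<Longrightarrow> k \<le> card (E `` {x})"
    and degY: "\<And>y. y \<in> Y \<Longrightarrow> k \<le> card (E\<inverse> `` {y})"
  shows "(\<exists>X0\<subseteq>X. card X0 = Suc k \<and> (\<forall>x\<in>X0. card (E `` {x}) \<le> k)) \<or>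
    (\<exists>Y0\<subseteq>Y. card Y0 = Suc k \<and> (\<forall>y\<in>Y0. card (E\<inverse> `` {y}) \<le> k)) \<or>
    (k = 1 \<and> (\<exists>x\<in>X. \<exists>y\<in>Y. E `` {x} = {y} \<and> E\<inverse> `` {y} = {x}))"
proof -
  let ?f = "\<lambda>(x, y). card (E `` {x}) + card (E\<inverse> `` {y})"
  let ?S = "X \<times> Y - E"
  have "?S \<noteq> {}"
  proof
    assume S: "?S = {}"
    have "card X \<le> card (E `` {x})" if "x \<in> X" for x
    proof -
      have "E `` {x} = Y" using S that E_sub by auto
      then show ?thesis using card_X card_Y by simp
    qed
    moreover have "X \<noteq> {}" using n card_X by (auto simp: power2_eq_square)
    ultimately show False using large_degrees_impossible[of X] by blast
  qed
  moreover have "finite ?S" using finite_X finite_Y by simp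
  ultimately have "Max (?f ` ?S) \<in> ?f ` ?S" by (intro Max_in) simp_all
  then obtain p where p: "p \<in> ?S" "Max (?f ` ?S) = ?f p" by (rule imageE)
  obtain x y where xy: "p = (x, y)" by (cases p)
  have max: "card (E `` {x'}) + card (E\<inverse> `` {y'}) \<le> card (E `` {x}) + card (E\<inverse> `` {y})"
    if "x' \<in> X" "y' \<in> Y" "(x', y') \<notin> E" for x' y'
  proof -
    have "?f (x', y') \<le> Max (?f ` ?S)"
      using that \<open>finite ?S\<close> by (intro Max_ge) auto
    then show ?thesis unfolding p(2) xy by simp
  qed
  have x: "x \<in> X" "y \<in> Y" "(x, y) \<notin> E" using p xy by auto
  show ?thesis
  proof (cases "card (E `` {x}) \<le> card (E\<inverse> `` {y})")
    case True
    from low_degree_structure_oriented[OF n e degX degY x max True] show ?thesis by blast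
  next
    case False
    interpret S: closed_bip Y X "E\<inverse>" n by (rule swapped_closed)
    have "(\<exists>Y0\<subseteq>Y. card Y0 = Suc k \<and> (\<forall>y\<in>Y0. card (E\<inverse> `` {y}) \<le> k)) \<or>
      (k = 1 \<and> (\<exists>y\<in>Y. \<exists>x\<in>X. E\<inverse> `` {y} = {x} \<and> (E\<inverse>)\<inverse> `` {x} = {y}))"
    proof (rule S.low_degree_structure_oriented[OF n _ degY _ x(2,1)])
      show "n * n \<le> card (E\<inverse>) + n * (k + 1)" using e by simp
    qed (use False x max degX in \<open>auto simp: add.commute\<close>)
    then show ?thesis by auto
  qed
qed

end

section \<open>Eigenfunctions\<close>

text \<open>A complex eigenvalue exists; the Hermitian form of a real symmetric matrix takes real
  values, so it is real, and the real or imaginary part of its eigenvector is a real eigenvector.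
  This ensures that the maximum defining the spectral radius is attained.\<close>

lemma real_symmetric_eigenvalue_exists:
  fixes A :: "real mat"
  assumes A: "A \<in> carrier_mat m m" and m: "0 < m"
    and sym: "\<And>i j. i < m \<Longrightarrow> j < m \<Longrightarrow> A $$ (i, j) = A $$ (j, i)"
  shows "spectrum A \<noteq> {}"
proof -
  let ?C = "map_mat complex_of_real A"
  have C: "?C \<in> carrier_mat m m" using A by simp
  obtain \<mu> where "eigenvalue ?C \<mu>"
    using spectrum_non_empty[OF C m] by (auto simp: spectrum_def)
  then obtain x where x: "x \<in> carrier_vec m" "x \<noteq> 0\<^sub>v m" "?C *\<^sub>v x = \<mu> \<cdot>\<^sub>v x"
    using A by (auto simp: eigenvalue_def eigenvector_def)
  have row: "(\<Sum>j<m. complex_of_real (A $$ (i, j)) * x $ j) = \<mu> * x $ i" if i: "i < m" for i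
  proof -
    have "(?C *\<^sub>v x) $ i = (\<Sum>j<m. complex_of_real (A $$ (i, j)) * x $ j)"
      using i A x(1) by (auto simp: scalar_prod_def atLeast0LessThan intro!: sum.cong)
    then show ?thesis using x i by simp
  qed
  \<comment> \<open>\<open>S\<close> is the squared norm of \<open>x\<close>, and
    \<open>\<mu> * S\<close> the value of the Hermitian form.\<close>
  define S where "S = (\<Sum>i<m. cnj (x $ i) * x $ i)"
  have "(\<Sum>i<m. \<Sum>j<m. cnj (x $ i) * (complex_of_real (A $$ (i, j)) * x $ j)) =
      (\<Sum>i<m. cnj (x $ i) * (\<mu> * x $ i))"
    by (intro sum.cong refl) (simp add: sum_distrib_left[symmetric] row)
  then have mS: "\<mu> * S = (\<Sum>i<m. \<Sum>j<m. cnj (x $ i) * (complex_of_real (A $$ (i, j)) * x $ j))"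
    by (simp add: S_def sum_distrib_left mult.left_commute)
  have "cnj (\<mu> * S) = (\<Sum>i<m. \<Sum>j<m. x $ i * (complex_of_real (A $$ (i, j)) * cnj (x $ j)))"
    unfolding mS by simp
  also have "\<dots> = (\<Sum>j<m. \<Sum>i<m. x $ i * (complex_of_real (A $$ (i, j)) * cnj (x $ j)))"
    by (rule sum.swap)
  also have "\<dots> = \<mu> * S"
    unfolding mS using sym by (intro sum.cong refl) (simp add: mult_ac)
  finally have "cnj \<mu> * cnj S = \<mu> * S" by simp
  moreover have Sr: "S = complex_of_real (\<Sum>i<m. (cmod (x $ i))\<^sup>2)"
    unfolding S_def of_real_sum
    by (intro sum.cong refl) (simp only: complex_norm_square mult.commute)
  then have "cnj S = S" by simp
  moreover have "S \<noteq> 0"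
  proof -
    obtain i where i: "i < m" "x $ i \<noteq> 0"
      using x(1,2) by (metis carrier_vecD eq_vecI index_zero_vec(1) index_zero_vec(2))
    then have "0 < (\<Sum>i<m. (cmod (x $ i))\<^sup>2)"
      by (intro sum_pos2[of _ i]) auto
    then show ?thesis unfolding Sr by (metis of_real_eq_0_iff less_irrefl)
  qed
  ultimately have "cnj \<mu> = \<mu>" by simp
  then obtain l where l: "\<mu> = complex_of_real l" by (metis Reals_cnj_iff Reals_cases)
  \<comment> \<open>\<open>h\<close> stands for the real or the imaginary part; both are additive
    and commute with real factors.\<close>
  have eig: "eigenvalue A l" if h: "h = Re \<or> h = Im" and nz: "\<exists>i<m. h (x $ i) \<noteq> 0" for h
  proof -
    let ?y = "vec m (\<lambda>i. h (x $ i))"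
    have hadd: "h (\<Sum>j<m. g j) = (\<Sum>j<m. h (g j))" for g
      using h by (auto simp: Re_sum Im_sum)
    have hmul: "h (complex_of_real c * z) = c * h z" for c z using h by auto
    have "A *\<^sub>v ?y = l \<cdot>\<^sub>v ?y"
    proof
      fix i assume "i < dim_vec (l \<cdot>\<^sub>v ?y)"
      then have i: "i < m" by simp
      have "(A *\<^sub>v ?y) $ i = (\<Sum>j<m. A $$ (i, j) * h (x $ j))"
        using i A by (auto simp: scalar_prod_def atLeast0LessThan intro!: sum.cong)
      also have "\<dots> = h (\<Sum>j<m. complex_of_real (A $$ (i, j)) * x $ j)"
        by (simp only: hadd hmul)
      also have "\<dots> = l * h (x $ i)" using row[OF i] l hmul by simp
      finally show "(A *\<^sub>v ?y) $ i = (l \<cdot>\<^sub>v ?y) $ i" using i by simp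
    qed (use A in auto)
    moreover have "?y \<noteq> 0\<^sub>v m"
    proof
      assume z: "?y = 0\<^sub>v m"
      obtain i where "i < m" "h (x $ i) \<noteq> 0" using nz by blast
      then have "?y $ i \<noteq> 0\<^sub>v m $ i" by simp
      then show False using z by simp
    qed
    ultimately show ?thesis
      using A unfolding eigenvalue_def eigenvector_def by (intro exI[of _ ?y]) auto
  qed
  obtain i where i: "i < m" "x $ i \<noteq> 0"
    using x(1,2) by (metis carrier_vecD eq_vecI index_zero_vec(1) index_zero_vec(2))
  then have "Re (x $ i) \<noteq> 0 \<or> Im (x $ i) \<noteq> 0" by (simp add: complex_eq_iff)
  then have "eigenvalue A l" using eig[of Re] eig[of Im] i by blast
  then show ?thesis by (auto simp: spectrum_def)
qed

text \<open>Eigenvectors as functions on the vertices, independent of any enumeration of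
  them.\<close>

definition eigenfunction :: "'a set \<Rightarrow> ('a \<times> 'a) set \<Rightarrow> real \<Rightarrow> ('a \<Rightarrow> real) \<Rightarrow> bool" where
  "eigenfunction V A l f \<longleftrightarrow> (\<exists>v\<in>V. f v \<noteq> 0) \<and>
     (\<forall>v\<in>V. (\<Sum>w\<in>V. if (v, w) \<in> A then f w else 0) = l * f v)"

lemma finite_spectrum_adj_matrix: "finite (spectrum (adj_matrix G vs))"
  using card_finite_spectrum(1)[of "adj_matrix G vs" "length vs"] by (simp add: adj_matrix_def)

lemma graph_spectral_radius_ge:
  assumes "finite (pverts G)" "eigenfunction (pverts G) (parcs G) l f"
  shows "l \<le> graph_spectral_radius G"
proof -
  obtain vs where vs: "set vs = pverts G" "distinct vs"
    using finite_distinct_list[OF assms(1)] by blast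
  have "eigenvalue (adj_matrix G vs) l"
    using assms(2) unfolding eigenvalue_adj_matrix_iff[OF vs(2)] eigenfunction_def vs(1) by blast
  then show ?thesis
    unfolding graph_spectral_radius_eq[OF vs(2,1)]
    by (intro Max_ge finite_spectrum_adj_matrix) (simp add: spectrum_def)
qed

lemma graph_spectral_radius_eigenfunction:
  assumes "finite (pverts G)" "pverts G \<noteq> {}" "sym (parcs G)"
  obtains f where "eigenfunction (pverts G) (parcs G) (graph_spectral_radius G) f"
proof -
  obtain vs where vs: "set vs = pverts G" "distinct vs"
    using finite_distinct_list[OF assms(1)] by blast
  have "spectrum (adj_matrix G vs) \<noteq> {}"
  proof (rule real_symmetric_eigenvalue_exists)
    show "0 < length vs" using vs assms(2) by auto
    show "adj_matrix G vs $$ (i, j) = adj_matrix G vs $$ (j, i)"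
      if "i < length vs" "j < length vs" for i j
      using that assms(3) by (auto simp: adj_matrix_def dest: symD)
  qed (simp add: adj_matrix_def)
  then have "graph_spectral_radius G \<in> spectrum (adj_matrix G vs)"
    unfolding graph_spectral_radius_eq[OF vs(2,1)] by (rule Max_in[OF finite_spectrum_adj_matrix])
  then show thesis
    using that unfolding spectrum_def mem_Collect_eq eigenvalue_adj_matrix_iff[OF vs(2)]
      eigenfunction_def vs(1) by blast
qed

section \<open>Two-step walk bounds\<close>

locale bip_eigenfunction = balanced_bip +
  fixes \<mu> :: real and f :: "'a \<Rightarrow> real"
  assumes eig: "eigenfunction (X \<union> Y) (E \<union> E\<inverse>) \<mu> f" and pos: "0 < \<mu>"
begin

lemma eigen_X: "x \<in> X \<Longrightarrow> (\<Sum>y\<in>E `` {x}. f y) = \<mu> * f x"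
proof -
  assume x: "x \<in> X"
  have "(\<Sum>w\<in>X \<union> Y. if (x, w) \<in> E \<union> E\<inverse> then f w else 0) = sum f {w \<in> X \<union> Y. (x, w) \<in> E \<union> E\<inverse>}"
    using finite_X finite_Y by (intro sum.inter_filter[symmetric]) simp
  also have "{w \<in> X \<union> Y. (x, w) \<in> E \<union> E\<inverse>} = E `` {x}"
    using x E_sub disjoint by auto
  finally show ?thesis using eig x by (auto simp: eigenfunction_def)
qed

lemma swapped_eigenfunction: "bip_eigenfunction Y X (E\<inverse>) n \<mu> f"
proof -
  interpret S: balanced_bip Y X "E\<inverse>" n by (rule swapped)
  show ?thesis
    by unfold_locales (use eig pos in \<open>simp_all add: Un_commute\<close>)
qed

lemma eigen_Y: "y \<in> Y \<Longrightarrow> (\<Sum>x\<in>E\<inverse> `` {y}. f x) = \<mu> * f y"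
  using bip_eigenfunction.eigen_X[OF swapped_eigenfunction] .

text \<open>\<open>S\<close> is the set of vertices where \<open>\<bar>f x\<bar> / z x\<close> is maximal.\<close>

lemma two_step:
  fixes P :: "('a \<times> 'a) set"
  assumes P: "E \<subseteq> P" "P \<subseteq> X \<times> Y"
    and z: "\<And>x. x \<in> X \<Longrightarrow> 0 < z x"
    and \<tau>: "\<tau> \<le> \<mu>\<^sup>2"
    and rows: "\<And>x. x \<in> X \<Longrightarrow> (\<Sum>y\<in>P `` {x}. \<Sum>x'\<in>P\<inverse> `` {y}. z x') \<le> \<tau> * z x"
  obtains S where "S \<subseteq> X" "S \<noteq> {}"
    "\<And>x. x \<in> S \<Longrightarrow> (\<Sum>y\<in>P `` {x}. \<Sum>x'\<in>P\<inverse> `` {y}. z x') = \<tau> * z x"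
    "\<And>x y x'. x \<in> S \<Longrightarrow> (x, y) \<in> P \<Longrightarrow> (x', y) \<in> P \<Longrightarrow> (x', y) \<in> E"
    "\<And>x y x'. x \<in> S \<Longrightarrow> (x, y) \<in> P \<Longrightarrow> (x', y) \<in> P \<Longrightarrow> x' \<in> S"
proof -
  have finP: "finite P" using P(2) finite_X finite_Y finite_subset by blast
  have fin: "finite (P `` A)" "finite (P\<inverse> `` A)" for A
    using finP by (simp_all add: finite_Image)
  \<comment> \<open>As \<open>\<mu>\<close> is positive, an eigenfunction vanishing on
    \<open>X\<close> would vanish on \<open>Y\<close> too.\<close>
  have ex: "\<exists>x\<in>X. f x \<noteq> 0"
  proof (rule ccontr)
    assume n: "\<not> (\<exists>x\<in>X. f x \<noteq> 0)"
    have "f y = 0" if "y \<in> Y" for y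
    proof -
      have "(\<Sum>x\<in>E\<inverse> `` {y}. f x) = 0"
        using n E_sub by (intro sum.neutral) auto
      then show ?thesis using eigen_Y[OF that] pos by simp
    qed
    then show False using n eig by (auto simp: eigenfunction_def)
  qed
  define r where "r = Max ((\<lambda>x. \<bar>f x\<bar> / z x) ` X)"
  have r: "\<bar>f x\<bar> \<le> r * z x" if "x \<in> X" for x
  proof -
    have "\<bar>f x\<bar> / z x \<le> r" unfolding r_def using that finite_X by (intro Max_ge) auto
    then show ?thesis using z[OF that] by (simp add: divide_le_eq)
  qed
  define S where "S = {x \<in> X. \<bar>f x\<bar> = r * z x}"
  obtain x1 where x1: "x1 \<in> X" "f x1 \<noteq> 0" using ex by blast
  have rpos: "0 < r"
  proof -
    have "0 < \<bar>f x1\<bar>" using x1 by simp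
    also have "\<dots> \<le> r * z x1" by (rule r[OF x1(1)])
    finally show ?thesis using z[OF x1(1)] by (simp add: zero_less_mult_iff)
  qed
  have "r \<in> (\<lambda>x. \<bar>f x\<bar> / z x) ` X"
    unfolding r_def using finite_X x1 by (intro Max_in) auto
  then obtain x2 where x2: "x2 \<in> X" "r = \<bar>f x2\<bar> / z x2" by blast
  have "x2 \<in> S" using x2 z[OF x2(1)] by (simp add: S_def)
  \<comment> \<open>At \<open>x\<close> in \<open>S\<close>,
    \<open>\<mu>\<^sup>2 * \<bar>f x\<bar>\<close> is at most the sum of
    \<open>\<bar>f x'\<bar>\<close> over the two-step walks in \<open>E\<close>. Enlarging
    \<open>E\<close> to \<open>P\<close> and \<open>\<bar>f x'\<bar>\<close> to
    \<open>r * z x'\<close> gives at most \<open>\<tau> * (r * z x)\<close>, which is at most the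
    initial value. So equality holds throughout.\<close>
  have key: "(\<Sum>y\<in>P `` {x}. \<Sum>x'\<in>P\<inverse> `` {y}. z x') = \<tau> * z x \<and>
      (\<forall>y\<in>P `` {x}. \<forall>x'\<in>P\<inverse> `` {y}. (x', y) \<in> E \<and> x' \<in> S)" if x: "x \<in> S" for x
  proof -
    have xX: "x \<in> X" and fx: "\<bar>f x\<bar> = r * z x" using x by (simp_all add: S_def)
    let ?R = "\<Sum>y\<in>P `` {x}. \<Sum>x'\<in>P\<inverse> `` {y}. z x'"
    define g where "g y x' = (if (x, y) \<in> E \<and> (x', y) \<in> E then \<bar>f x'\<bar> else 0)" for y x'
    have g_le: "g y x' \<le> r * z x'" if "x' \<in> P\<inverse> `` {y}" for y x'
      using r[of x'] that P(2) z[of x'] rpos by (auto simp: g_def)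
    have "\<mu>\<^sup>2 * f x = \<mu> * (\<Sum>y\<in>E `` {x}. f y)"
      using eigen_X[OF xX] by (simp add: power2_eq_square)
    also have "\<dots> = (\<Sum>y\<in>E `` {x}. \<Sum>x'\<in>E\<inverse> `` {y}. f x')"
      using E_sub by (auto simp: sum_distrib_left eigen_Y intro!: sum.cong)
    finally have "\<mu>\<^sup>2 * \<bar>f x\<bar> = \<bar>\<Sum>y\<in>E `` {x}. \<Sum>x'\<in>E\<inverse> `` {y}. f x'\<bar>"
      by (metis abs_mult abs_of_nonneg zero_le_power2)
    also have "\<dots> \<le> (\<Sum>y\<in>E `` {x}. \<Sum>x'\<in>E\<inverse> `` {y}. \<bar>f x'\<bar>)"
      by (intro order_trans[OF sum_abs] sum_mono sum_abs)
    also have "\<dots> = (\<Sum>y\<in>E `` {x}. \<Sum>x'\<in>E\<inverse> `` {y}. g y x')"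
      by (intro sum.cong) (auto simp: g_def)
    also have "\<dots> = (\<Sum>y\<in>E `` {x}. \<Sum>x'\<in>P\<inverse> `` {y}. g y x')"
      using P(1) by (intro sum.cong sum.mono_neutral_left fin) (auto simp: g_def)
    also have "\<dots> = (\<Sum>y\<in>P `` {x}. \<Sum>x'\<in>P\<inverse> `` {y}. g y x')"
      using P(1) by (intro sum.mono_neutral_left fin) (auto simp: g_def)
    finally have lower: "\<mu>\<^sup>2 * \<bar>f x\<bar> \<le> (\<Sum>y\<in>P `` {x}. \<Sum>x'\<in>P\<inverse> `` {y}. g y x')" .
    have upper: "(\<Sum>y\<in>P `` {x}. \<Sum>x'\<in>P\<inverse> `` {y}. g y x') \<le> r * ?R"
      unfolding sum_distrib_left by (intro sum_mono g_le)
    have "\<tau> * (r * z x) \<le> \<mu>\<^sup>2 * (r * z x)"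
      using \<tau> rpos z[OF xX] by (intro mult_right_mono) auto
    moreover have rR: "r * ?R \<le> r * (\<tau> * z x)"
      using rows[OF xX] rpos by (intro mult_left_mono) auto
    moreover have "r * (\<tau> * z x) = \<tau> * (r * z x)" by simp
    ultimately have closing: "r * ?R \<le> \<mu>\<^sup>2 * \<bar>f x\<bar>" "r * (\<tau> * z x) \<le> \<mu>\<^sup>2 * \<bar>f x\<bar>"
      unfolding fx by (simp_all only: order_trans)
    have eq: "(\<Sum>y\<in>P `` {x}. \<Sum>x'\<in>P\<inverse> `` {y}. g y x') = r * ?R"
      by (rule order_antisym[OF upper order_trans[OF closing(1) lower]])
    have eq': "r * ?R = r * (\<tau> * z x)"
      by (rule order_antisym[OF rR order_trans[OF closing(2) order_trans[OF lower upper]]])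
    have R: "?R = \<tau> * z x" using eq' rpos by simp
    \<comment> \<open>Equal sums of termwise comparable terms agree termwise: each walk in
      \<open>P\<close> has \<open>g y x' = r * z x'\<close>, which is positive, so both its edges
      are in \<open>E\<close> and its end is in \<open>S\<close>.\<close>
    have "(\<Sum>y\<in>P `` {x}. \<Sum>x'\<in>P\<inverse> `` {y}. r * z x' - g y x') = 0"
      using eq by (simp add: sum_subtractf sum_distrib_left)
    then have "\<forall>y\<in>P `` {x}. (\<Sum>x'\<in>P\<inverse> `` {y}. r * z x' - g y x') = 0"
      using g_le fin by (subst (asm) sum_nonneg_eq_0_iff) (auto intro!: sum_nonneg)
    then have zero: "\<forall>y\<in>P `` {x}. \<forall>x'\<in>P\<inverse> `` {y}. r * z x' - g y x' = 0"
      using g_le fin by (subst (asm) sum_nonneg_eq_0_iff) auto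
    have "(x', y) \<in> E \<and> x' \<in> S" if "y \<in> P `` {x}" "x' \<in> P\<inverse> `` {y}" for y x'
    proof -
      have x': "x' \<in> X" using that P(2) by auto
      have "g y x' = r * z x'" using zero that by simp
      moreover have "0 < r * z x'" using rpos z[OF x'] by simp
      ultimately show ?thesis using x' by (auto simp: g_def S_def split: if_splits)
    qed
    then show ?thesis using R by (intro conjI ballI) auto
  qed
  show thesis
  proof (rule that[of S])
    show "S \<subseteq> X" by (auto simp: S_def)
    show "S \<noteq> {}" using \<open>x2 \<in> S\<close> by blast
    show "(x', y) \<in> E" "x' \<in> S" if "x \<in> S" "(x, y) \<in> P" "(x', y) \<in> P" for x y x'
      using conjunct2[OF key[OF that(1)]] that(2,3) by auto
  qed (use key in blast)
qed

text \<open>With constant weight, \<open>two_step\<close> counts walks of length two from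
  \<open>x\<close>. Each is determined by its second edge, so there are at most
  \<open>card E\<close>, and a larger \<open>\<mu>\<^sup>2\<close> would contradict the equality on
  \<open>S\<close>.\<close>

lemma square_le_card: "\<mu>\<^sup>2 \<le> card E"
proof (rule ccontr)
  assume lt: "\<not> \<mu>\<^sup>2 \<le> card E"
  have row: "(\<Sum>y\<in>E `` {x}. \<Sum>x'\<in>E\<inverse> `` {y}. 1) \<le> real (card E)" for x
  proof -
    have "(\<Sum>y\<in>E `` {x}. \<Sum>x'\<in>E\<inverse> `` {y}. 1) = real (card (SIGMA y:E `` {x}. E\<inverse> `` {y}))"
      by (subst card_SigmaI) auto
    also have "card (SIGMA y:E `` {x}. E\<inverse> `` {y}) \<le> card E"
      by (rule card_inj_on_le[where f = prod.swap]) (use finite_E in auto)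
    finally show ?thesis by simp
  qed
  have row': "(\<Sum>y\<in>E `` {x}. \<Sum>x'\<in>E\<inverse> `` {y}. 1) \<le> \<mu>\<^sup>2 * 1" for x
    using row[of x] lt by linarith
  obtain S where S: "S \<noteq> {}" "\<And>x. x \<in> S \<Longrightarrow> (\<Sum>y\<in>E `` {x}. \<Sum>x'\<in>E\<inverse> `` {y}. 1) = \<mu>\<^sup>2 * 1"
  proof (rule two_step[where P = E and z = "\<lambda>_. 1" and \<tau> = "\<mu>\<^sup>2"])
    show "E \<subseteq> X \<times> Y" by (rule E_sub)
    show "(\<Sum>y\<in>E `` {x}. \<Sum>x'\<in>E\<inverse> `` {y}. 1) \<le> \<mu>\<^sup>2 * 1" for x
      by (rule row')
  qed simp_all
  obtain x where "x \<in> S" using S(1) by blast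
  then show False using row[of x] lt S(2) by simp
qed

text \<open>\<open>P\<close> is the largest bipartite graph in which \<open>x0\<close> and
  \<open>y0\<close> form an isolated edge. Its walk counts are \<open>1\<close> at \<open>x0\<close>
  and \<open>(n - 1)\<^sup>2\<close> elsewhere, so equality occurs at a vertex other than
  \<open>x0\<close> and forces the whole second component of \<open>P\<close> into
  \<open>E\<close>.\<close>

lemma isolated_edge_extremal:
  assumes xy: "x0 \<in> X" "y0 \<in> Y" "E `` {x0} = {y0}" "E\<inverse> `` {y0} = {x0}"
    and n: "3 \<le> n" and \<mu>: "(real n - 1)\<^sup>2 \<le> \<mu>\<^sup>2"
  shows "E = {(x0, y0)} \<union> (X - {x0}) \<times> (Y - {y0})"
proof -
  define P where "P = {(x0, y0)} \<union> (X - {x0}) \<times> (Y - {y0})"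
  let ?W = "\<lambda>x. \<Sum>y\<in>P `` {x}. \<Sum>x'\<in>P\<inverse> `` {y}. 1 :: real"
  have EP: "E \<subseteq> P" using xy E_sub by (auto simp: P_def)
  have PXY: "P \<subseteq> X \<times> Y" using xy by (auto simp: P_def)
  have Px0: "P `` {x0} = {y0}" "P\<inverse> `` {y0} = {x0}" by (auto simp: P_def)
  have Px: "P `` {x} = Y - {y0}" if "x \<in> X" "x \<noteq> x0" for x using that by (auto simp: P_def)
  have Py: "P\<inverse> `` {y} = X - {x0}" if "y \<in> Y - {y0}" for y using that by (auto simp: P_def)
  have W0: "?W x0 = 1" by (simp add: Px0)
  have W: "?W x = (real n - 1)\<^sup>2" if "x \<in> X" "x \<noteq> x0" for x
  proof -
    have "?W x = (\<Sum>y\<in>Y - {y0}. real (card (X - {x0})))"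
      unfolding Px[OF that] by (intro sum.cong) (use Py in auto)
    then show ?thesis
      using xy n card_X card_Y finite_X finite_Y by (simp add: power2_eq_square of_nat_diff)
  qed
  have big: "1 < (real n - 1)\<^sup>2" using n by (intro one_less_power) auto
  obtain S where S: "S \<subseteq> X" "S \<noteq> {}" "\<And>x. x \<in> S \<Longrightarrow> ?W x = (real n - 1)\<^sup>2 * 1"
    "\<And>x y x'. x \<in> S \<Longrightarrow> (x, y) \<in> P \<Longrightarrow> (x', y) \<in> P \<Longrightarrow> (x', y) \<in> E"
  proof (rule two_step[OF EP PXY _ \<mu>, of "\<lambda>_. 1"])
    show "?W x \<le> (real n - 1)\<^sup>2 * 1" if "x \<in> X" for x
      using W0 W[OF that] big by (cases "x = x0") auto
  qed auto
  obtain x where x: "x \<in> S" using S(2) by blast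
  have "x \<noteq> x0" using S(3)[OF x] W0 big by auto
  then have "(x', y) \<in> E" if "x' \<in> X - {x0}" "y \<in> Y - {y0}" for x' y
    using S(4)[OF x, of y x'] that S(1) x by (auto simp: P_def)
  moreover have "(x0, y0) \<in> E" using xy by blast
  ultimately show ?thesis using EP unfolding P_def by blast
qed

text \<open>Weight \<open>a\<close> on \<open>X0\<close> and \<open>1\<close> elsewhere;
  \<open>P\<close> completes only the rows outside \<open>X0\<close>, so the neighbourhoods of
  \<open>X0\<close> may be arbitrary. \<open>t1\<close> and \<open>t2\<close> are the walk
  conditions for vertices outside and inside \<open>X0\<close>. Equality makes all degrees in
  \<open>X0\<close> equal to \<open>k\<close> and all their neighbourhoods the same.\<close>

lemma low_degree_extremal:
  fixes a t :: real
  assumes X0: "X0 \<subseteq> X" "card X0 = Suc k" "\<And>x. x \<in> X0 \<Longrightarrow> card (E `` {x}) \<le> k"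
    and n: "Suc k < n" and a: "0 < a" and t: "0 < t" and \<mu>: "t \<le> \<mu>\<^sup>2"
    and t1: "real n * real (n - Suc k) + k * Suc k * a \<le> t"
    and t2: "k * (real (n - Suc k) + Suc k * a) \<le> t * a"
  shows "t = real n * real (n - Suc k) + k * Suc k * a \<and>
    (\<exists>F\<subseteq>Y. card F = k \<and> E = (X - X0) \<times> Y \<union> X0 \<times> F)"
proof -
  define P where "P = (X - X0) \<times> Y \<union> E"
  define z where "z x = (if x \<in> X0 then a else 1)" for x
  define c where "c y = card (E\<inverse> `` {y} \<inter> X0)" for y
  let ?p = "real (n - Suc k)"
  let ?W = "\<lambda>x. \<Sum>y\<in>P `` {x}. \<Sum>x'\<in>P\<inverse> `` {y}. z x'"
  have fin: "finite X0" using X0 finite_X finite_subset by blast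
  have EP: "E \<subseteq> P" and PXY: "P \<subseteq> X \<times> Y" using E_sub by (auto simp: P_def)
  have P1: "P `` {x} = Y" if "x \<in> X - X0" for x using that E_sub by (auto simp: P_def)
  have P0: "P `` {x} = E `` {x}" if "x \<in> X0" for x using that by (auto simp: P_def)
  have card1: "card (X - X0) = n - Suc k" using X0 fin card_X by (simp add: card_Diff_subset)
  have col: "(\<Sum>x'\<in>P\<inverse> `` {y}. z x') = ?p + c y * a" if "y \<in> Y" for y
  proof -
    have "P\<inverse> `` {y} = (X - X0) \<union> (E\<inverse> `` {y} \<inter> X0)" using that E_sub by (auto simp: P_def)
    also have "sum z \<dots> = sum z (X - X0) + sum z (E\<inverse> `` {y} \<inter> X0)"
      using finite_X fin by (intro sum.union_disjoint) auto
    also have "sum z (X - X0) = ?p" using card1 by (simp add: z_def)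
    also have "sum z (E\<inverse> `` {y} \<inter> X0) = c y * a" by (simp add: z_def c_def)
    finally show ?thesis .
  qed
  have cle: "c y \<le> Suc k" for y
    unfolding c_def X0(2)[symmetric] using fin by (intro card_mono) auto
  \<comment> \<open>Double counting: walks from outside \<open>X0\<close> into \<open>X0\<close> use
    each edge at \<open>X0\<close> once, so their weight depends on the number of those edges and
    not on their arrangement.\<close>
  have csum: "(\<Sum>y\<in>Y. c y) = (\<Sum>x\<in>X0. card (E `` {x}))"
  proof -
    have "(\<Sum>y\<in>Y. c y) = card (SIGMA y:Y. E\<inverse> `` {y} \<inter> X0)"
      unfolding c_def using finite_Y fin by (subst card_SigmaI) auto
    also have "\<dots> = card (SIGMA x:X0. E `` {x})"
      by (rule bij_betw_same_card[of prod.swap])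
        (use E_sub in \<open>auto simp: bij_betw_def inj_on_def image_iff\<close>)
    also have "\<dots> = (\<Sum>x\<in>X0. card (E `` {x}))" using fin by (subst card_SigmaI) auto
    finally show ?thesis .
  qed
  have W1: "?W x = real n * ?p + real (\<Sum>x\<in>X0. card (E `` {x})) * a" if "x \<in> X - X0" for x
  proof -
    have "?W x = (\<Sum>y\<in>Y. ?p + c y * a)" unfolding P1[OF that] by (intro sum.cong col) auto
    also have "\<dots> = real n * ?p + real (\<Sum>y\<in>Y. c y) * a"
      by (simp add: sum.distrib card_Y sum_distrib_right)
    finally show ?thesis using csum by simp
  qed
  have W0: "?W x = (\<Sum>y\<in>E `` {x}. ?p + c y * a)" if "x \<in> X0" for x
    unfolding P0[OF that] using nb_sub(1) by (intro sum.cong col) auto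
  have dsum: "(\<Sum>x\<in>X0. card (E `` {x})) \<le> k * Suc k"
    using sum_mono[of X0 "\<lambda>x. card (E `` {x})" "\<lambda>_. k"] X0 by simp
  have t2': "k * (?p + Suc k * a) \<le> t * a" using t2 .
  have cbound: "?p + c y * a \<le> ?p + Suc k * a" for y
    using cle[of y] a by (intro add_left_mono mult_right_mono) auto
  have nonneg: "0 \<le> ?p + Suc k * a" using a by simp
  have W0le: "?W x \<le> card (E `` {x}) * (?p + Suc k * a)" if "x \<in> X0" for x
    unfolding W0[OF that]
    using sum_mono[of "E `` {x}" "\<lambda>y. ?p + c y * a" "\<lambda>_. ?p + Suc k * a"] cbound by simp
  obtain S where S: "S \<subseteq> X" "S \<noteq> {}" "\<And>x. x \<in> S \<Longrightarrow> ?W x = t * z x"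
    "\<And>x y x'. x \<in> S \<Longrightarrow> (x, y) \<in> P \<Longrightarrow> (x', y) \<in> P \<Longrightarrow> (x', y) \<in> E"
    "\<And>x y x'. x \<in> S \<Longrightarrow> (x, y) \<in> P \<Longrightarrow> (x', y) \<in> P \<Longrightarrow> x' \<in> S"
  proof (rule two_step[OF EP PXY _ \<mu>, of z])
    show "0 < z x" for x using a by (simp add: z_def)
    show "?W x \<le> t * z x" if x: "x \<in> X" for x
    proof (cases "x \<in> X0")
      case True
      have "?W x \<le> card (E `` {x}) * (?p + Suc k * a)" by (rule W0le[OF True])
      also have "\<dots> \<le> k * (?p + Suc k * a)"
        using X0(3)[OF True] nonneg by (intro mult_right_mono) auto
      finally show ?thesis using t2' True by (simp add: z_def)
    next
      case False
      have "real (\<Sum>x\<in>X0. card (E `` {x})) * a \<le> real (k * Suc k) * a"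
        using dsum a by (intro mult_right_mono) (simp_all only: of_nat_le_iff less_imp_le)
      then show ?thesis using W1[of x] x False t1 by (simp add: z_def)
    qed
  qed auto
  \<comment> \<open>A vertex of \<open>X0\<close> in \<open>S\<close> has a neighbour because
    \<open>t * a\<close> is positive, and two steps through it reach \<open>X - X0\<close>.\<close>
  have "\<exists>x1. x1 \<in> S \<and> x1 \<in> X - X0"
  proof -
    obtain x where x: "x \<in> S" using S(2) by blast
    show ?thesis
    proof (cases "x \<in> X0")
      case True
      have "?W x \<noteq> 0" using S(3)[OF x] t a True by (simp add: z_def)
      then have "E `` {x} \<noteq> {}" using W0[OF True] by auto
      then obtain y where y: "(x, y) \<in> E" by blast
      have "card (X - X0) \<noteq> 0" using card1 n by simp
      then obtain x1 where x1: "x1 \<in> X - X0" by (metis card.empty equals0I)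
      then have "(x1, y) \<in> P" using y E_sub by (auto simp: P_def)
      then show ?thesis using S(5)[OF x, of y x1] y EP x1 by blast
    qed (use x S(1) in blast)
  qed
  then obtain x1 where x1: "x1 \<in> S" "x1 \<in> X - X0" by blast
  have x1P: "(x1, y) \<in> P" if "y \<in> Y" for y using x1 that by (auto simp: P_def)
  \<comment> \<open>\<open>P\<close> joins \<open>x1\<close> to all of \<open>Y\<close>, so equality
    spreads from \<open>x1\<close> to every pair in \<open>P\<close>.\<close>
  have full: "(x, y) \<in> E" if "x \<in> X - X0" "y \<in> Y" for x y
    using S(4)[OF x1(1) x1P[OF that(2)], of x] that by (simp add: P_def)
  have teq': "real n * ?p + real (\<Sum>x\<in>X0. card (E `` {x})) * a = t"
    using S(3)[OF x1(1)] W1[OF x1(2)] x1 by (simp add: z_def)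
  then have "real (k * Suc k) * a \<le> real (\<Sum>x\<in>X0. card (E `` {x})) * a"
    using t1 by simp
  then have "k * Suc k \<le> (\<Sum>x\<in>X0. card (E `` {x}))"
    using a by (simp only: mult_le_cancel_right_pos of_nat_le_iff)
  then have d: "(\<Sum>x\<in>X0. card (E `` {x})) = k * Suc k"
    by (rule order_antisym[OF dsum])
  have teq: "t = real n * ?p + k * Suc k * a"
    using teq'[symmetric] unfolding d .
  have deg: "card (E `` {x}) = k" if "x \<in> X0" for x
  proof (rule ccontr)
    assume "card (E `` {x}) \<noteq> k"
    then have "card (E `` {x}) < k" using X0(3)[OF that] by simp
    then have "(\<Sum>x\<in>X0. card (E `` {x})) < (\<Sum>x\<in>X0. k)"
      using X0(3) that fin by (intro sum_strict_mono_ex1) auto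
    then show False using d X0(2) by simp
  qed
  have all: "(x', y) \<in> E" if x: "x \<in> X0" "(x, y) \<in> E" and x': "x' \<in> X0" for x y x'
  proof -
    have "y \<in> Y" using x E_sub by auto
    then have xS: "x \<in> S" using S(5)[OF x1(1) x1P] x EP by blast
    have 1: "(\<Sum>y\<in>E `` {x}. ?p + c y * a) = t * a"
      using S(3)[OF xS] W0[OF x(1)] x by (simp add: z_def)
    have 2: "(\<Sum>y\<in>E `` {x}. ?p + Suc k * a) = k * (?p + Suc k * a)"
      using deg[OF x(1)] by simp
    have ge: "(\<Sum>y\<in>E `` {x}. ?p + Suc k * a) \<le> (\<Sum>y\<in>E `` {x}. ?p + c y * a)"
      unfolding 1 2 by (rule t2')
    have "c y = Suc k"
    proof (rule ccontr)
      assume "c y \<noteq> Suc k"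
      then have "c y < Suc k" using cle[of y] by simp
      then have "?p + c y * a < ?p + Suc k * a" using a by simp
      then have "(\<Sum>y\<in>E `` {x}. ?p + c y * a) < (\<Sum>y\<in>E `` {x}. ?p + Suc k * a)"
        using x cbound by (intro sum_strict_mono_ex1) auto
      then show False using ge by simp
    qed
    then have "E\<inverse> `` {y} \<inter> X0 = X0"
      unfolding c_def X0(2)[symmetric] using fin by (intro card_subset_eq) auto
    then show ?thesis using x' by blast
  qed
  obtain x0 where x0: "x0 \<in> X0" using X0(2) by (metis card.empty equals0I nat.distinct(1))
  have mem: "p \<in> E \<longleftrightarrow> p \<in> (X - X0) \<times> Y \<union> X0 \<times> (E `` {x0})" for p
  proof (cases p)
    case (Pair x y)
    have "(x, y) \<in> E \<longleftrightarrow> (x0, y) \<in> E" if "x \<in> X0"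
      using all[of x y x0] all[of x0 y x] that x0 by blast
    moreover have "(x, y) \<in> E \<longleftrightarrow> y \<in> Y" if "x \<in> X - X0"
      using full[OF that] E_sub by blast
    moreover have "x \<in> X" if "(x, y) \<in> E" using that E_sub by blast
    ultimately show ?thesis unfolding Pair by auto
  qed
  have E: "E = (X - X0) \<times> Y \<union> X0 \<times> (E `` {x0})" by (rule Set.set_eqI, rule mem)
  show ?thesis
    using teq by (intro conjI exI[of _ "E `` {x0}"] nb_sub(1) deg[OF x0] E)
qed

end

section \<open>Graphs with a block structure\<close>

text \<open>A blow-up of the pattern \<open>R\<close>: adjacency depends only on the classes
  \<open>c\<close>, and class \<open>i\<close> has \<open>ns ! i\<close> vertices. Pattern and sizes
  determine the graph up to isomorphism.\<close>

definition block_graph ::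
  "'a pair_pre_digraph \<Rightarrow> ('a \<Rightarrow> nat) \<Rightarrow> (nat \<times> nat) set \<Rightarrow> nat list \<Rightarrow> bool" where
  "block_graph G c R ns \<longleftrightarrow> finite (pverts G) \<and> (\<forall>v\<in>pverts G. c v < length ns) \<and>
     (\<forall>i<length ns. card {v \<in> pverts G. c v = i} = ns ! i) \<and>
     parcs G = {(u, v). u \<in> pverts G \<and> v \<in> pverts G \<and> (c u, c v) \<in> R}"

lemma block_graphI:
  assumes "pverts G = V" "finite V" "\<And>v. v \<in> V \<Longrightarrow> c v < length ns"
    and "\<And>i. i < length ns \<Longrightarrow> card {v \<in> V. c v = i} = ns ! i"
    and arcs: "\<And>u v. (u, v) \<in> parcs G \<longleftrightarrow> u \<in> V \<and> v \<in> V \<and> (c u, c v) \<in> R"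
  shows "block_graph G c R ns"
proof -
  have "parcs G = {(u, v). u \<in> V \<and> v \<in> V \<and> (c u, c v) \<in> R}"
    by (rule Set.set_eqI) (simp add: arcs split: prod.split)
  then show ?thesis using assms(1-4) by (simp add: block_graph_def)
qed

text \<open>Arbitrary bijections between corresponding classes glue to an isomorphism, because
  adjacency sees only the classes.\<close>

lemma block_graph_isomorphic:
  assumes G: "block_graph G c R ns" and H: "block_graph H d R ns"
  shows "isomorphic G H"
proof -
  have "\<exists>g. bij_betw g {v \<in> pverts G. c v = i} {v \<in> pverts H. d v = i}" if "i < length ns" for i
    using that G H by (intro finite_same_card_bij) (auto simp: block_graph_def)
  then obtain g where g: "\<And>i. i < length ns \<Longrightarrow>
      bij_betw (g i) {v \<in> pverts G. c v = i} {v \<in> pverts H. d v = i}" by metis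
  define f where "f v = g (c v) v" for v
  have f: "f v \<in> pverts H \<and> d (f v) = c v" if "v \<in> pverts G" for v
  proof -
    have "c v < length ns" using that G by (auto simp: block_graph_def)
    from bij_betwE[OF g[OF this]] show ?thesis using that by (auto simp: f_def)
  qed
  have inj: "inj_on f (pverts G)"
  proof (rule inj_onI)
    fix u v assume uv: "u \<in> pverts G" "v \<in> pverts G" "f u = f v"
    then have c: "c u = c v" using f by metis
    have "c u < length ns" using uv G by (auto simp: block_graph_def)
    from bij_betw_imp_inj_on[OF g[OF this]] show "u = v"
      by (rule inj_onD) (use uv c in \<open>auto simp: f_def\<close>)
  qed
  have img: "f ` pverts G = pverts H"
  proof
    show "f ` pverts G \<subseteq> pverts H" using f by auto
    show "pverts H \<subseteq> f ` pverts G"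
    proof
      fix w assume w: "w \<in> pverts H"
      then have "d w < length ns" using H by (auto simp: block_graph_def)
      from bij_betw_imp_surj_on[OF g[OF this]] obtain v
        where v: "v \<in> pverts G" "c v = d w" "w = g (d w) v" using w by blast
      then have "w = f v" by (simp add: f_def)
      then show "w \<in> f ` pverts G" using v(1) by blast
    qed
  qed
  have arcs: "map_prod f f ` parcs G = parcs H"
  proof
    show "map_prod f f ` parcs G \<subseteq> parcs H"
      using f G H by (auto simp: block_graph_def)
    show "parcs H \<subseteq> map_prod f f ` parcs G"
    proof
      fix e assume e: "e \<in> parcs H"
      obtain w w' where ww: "e = (w, w')" "w \<in> pverts H" "w' \<in> pverts H" "(d w, d w') \<in> R"
        using e H by (auto simp: block_graph_def)
      obtain v v' where v: "v \<in> pverts G" "w = f v" "v' \<in> pverts G" "w' = f v'"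
        using ww(2,3) unfolding img[symmetric] by blast
      then have "(c v, c v') \<in> R" using ww(4) f by metis
      then have "(v, v') \<in> parcs G" using v G by (auto simp: block_graph_def)
      then have "map_prod f f (v, v') \<in> map_prod f f ` parcs G" by (rule imageI)
      then show "e \<in> map_prod f f ` parcs G" using ww v by simp
    qed
  qed
  have arcs_sub: "parcs G \<subseteq> pverts G \<times> pverts G" using G by (auto simp: block_graph_def)
  let ?h = "\<lparr>iso_verts = f, iso_arcs = map_prod f f, iso_head = snd, iso_tail = fst\<rparr>"
  have "wf_digraph (with_proj G)" using arcs_sub by unfold_locales auto
  moreover have "inj_on (map_prod f f) (parcs G)"
    by (rule inj_on_subset[OF map_prod_inj_on[OF inj inj] arcs_sub])
  ultimately have "pre_digraph.digraph_isomorphism (with_proj G) ?h"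
    using inj by (auto simp: pre_digraph.digraph_isomorphism_def)
  moreover have "with_proj H = app_iso ?h (with_proj G)"
    using img arcs by (simp add: app_iso_def with_proj_def)
  ultimately show ?thesis unfolding isomorphic_def digraph_iso_def by blast
qed

text \<open>An eigenvector of the quotient matrix lifts to an eigenfunction that is constant on the
  classes.\<close>

lemma block_graph_eigenfunction:
  assumes G: "block_graph G c R ns"
    and w: "\<And>i. i < length ns \<Longrightarrow>
      (\<Sum>j<length ns. if (i, j) \<in> R then real (ns ! j) * w j else 0) = l * w i"
    and nz: "i < length ns" "0 < ns ! i" "w i \<noteq> 0"
  shows "eigenfunction (pverts G) (parcs G) l (\<lambda>v. w (c v))"
  unfolding eigenfunction_def
proof (intro conjI ballI)
  let ?V = "pverts G"
  have "card {v \<in> ?V. c v = i} = ns ! i" using G nz(1) by (simp add: block_graph_def)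
  then have "{v \<in> ?V. c v = i} \<noteq> {}" using nz(2) by (metis card.empty less_irrefl)
  then show "\<exists>v\<in>?V. w (c v) \<noteq> 0" using nz by auto
  fix v assume v: "v \<in> ?V"
  have "(\<Sum>u\<in>?V. if (v, u) \<in> parcs G then w (c u) else 0) =
      (\<Sum>u\<in>?V. if (c v, c u) \<in> R then w (c u) else 0)"
    using G v by (intro sum.cong) (auto simp: block_graph_def)
  also have "\<dots> = (\<Sum>j<length ns. \<Sum>u\<in>{u \<in> ?V. c u = j}. if (c v, c u) \<in> R then w (c u) else 0)"
    using G by (intro sum.group[symmetric]) (auto simp: block_graph_def)
  also have "\<dots> = (\<Sum>j<length ns. if (c v, j) \<in> R then real (ns ! j) * w j else 0)"
  proof (rule sum.cong[OF refl])
    fix j assume "j \<in> {..<length ns}"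
    then have "card {u \<in> ?V. c u = j} = ns ! j" using G by (auto simp: block_graph_def)
    then show "(\<Sum>u\<in>{u \<in> ?V. c u = j}. if (c v, c u) \<in> R then w (c u) else 0) =
        (if (c v, j) \<in> R then real (ns ! j) * w j else 0)"
      by simp
  qed
  also have "\<dots> = l * w (c v)" using w[of "c v"] v G by (auto simp: block_graph_def)
  finally show "(\<Sum>u\<in>?V. if (v, u) \<in> parcs G then w (c u) else 0) = l * w (c v)" .
qed

text \<open>Classes \<open>0\<close> and \<open>1\<close> are the parts of the first graph of a
  union or join, \<open>2\<close> and \<open>3\<close> those of the second.\<close>

fun quarter :: "('a + 'b) + ('c + 'd) \<Rightarrow> nat" where
  "quarter (Inl (Inl _)) = 0"
| "quarter (Inl (Inr _)) = 1"
| "quarter (Inr (Inl _)) = 2"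
| "quarter (Inr (Inr _)) = 3"

lemma quarter_eq_image:
  "{v \<in> (A <+> B) <+> (C <+> D). quarter v = 0} = Inl ` Inl ` A"
  "{v \<in> (A <+> B) <+> (C <+> D). quarter v = 1} = Inl ` Inr ` B"
  "{v \<in> (A <+> B) <+> (C <+> D). quarter v = 2} = Inr ` Inl ` C"
  "{v \<in> (A <+> B) <+> (C <+> D). quarter v = 3} = Inr ` Inr ` D"
  by auto

lemma card_quarter:
  assumes "i < 4"
  shows "card {v \<in> ({..<n0} <+> {..<n1}) <+> ({..<n2} <+> {..<n3}). quarter v = i} = [n0, n1, n2, n3] ! i"
proof -
  have "i = 0 \<or> i = 1 \<or> i = 2 \<or> i = 3" using assms by auto
  then show ?thesis
    by (elim disjE) (simp_all only: quarter_eq_image, simp_all add: card_image)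
qed

lemma quarter_less: "quarter v < length [n0, n1, n2, n3]"
  by (cases v rule: quarter.cases) auto

definition Q_pattern :: "(nat \<times> nat) set" where
  "Q_pattern = {(0, 1), (1, 0), (0, 3), (3, 0), (1, 2), (2, 1)}"

definition R_pattern :: "(nat \<times> nat) set" where
  "R_pattern = {(0, 1), (1, 0), (2, 3), (3, 2)}"

lemma mem_map_prod:
  "(u, v) \<in> map_prod g g ` A \<longleftrightarrow> (\<exists>a b. u = g a \<and> v = g b \<and> (a, b) \<in> A)"
  by force

lemma block_graph_Q:
  "block_graph (ugraph (Q_graph n k)) quarter Q_pattern [k, n - k - 1, n - k, k + 1]"
proof -
  have V: "pverts (ugraph (Q_graph n k)) =
      ({..<k} <+> {..<n - k - 1}) <+> ({..<n - k} <+> {..<k + 1})" (is "_ = ?V")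
    by (auto simp: Q_graph_def bigraph_join_def bigraph_union_def complete_bigraph_def
        empty_bigraph_def mk_bigraph_def Let_def)
  have A: "(u, v) \<in> parcs (ugraph (Q_graph n k)) \<longleftrightarrow>
      u \<in> ?V \<and> v \<in> ?V \<and> (quarter u, quarter v) \<in> Q_pattern" for u v
    by (cases u rule: quarter.cases; cases v rule: quarter.cases)
      (auto simp: Q_graph_def bigraph_join_def bigraph_union_def complete_bigraph_def
        empty_bigraph_def mk_bigraph_def Let_def Q_pattern_def mem_map_prod)
  show ?thesis
    by (rule block_graphI[OF V])
      (use A card_quarter[of _ k "n - k - 1" "n - k" "k + 1"] quarter_less in \<open>simp_all add: finite_Plus\<close>)
qed

lemma block_graph_R:
  "block_graph (ugraph (R_graph n k)) quarter R_pattern [k, k, n - k, n - k]"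
proof -
  have V: "pverts (ugraph (R_graph n k)) =
      ({..<k} <+> {..<k}) <+> ({..<n - k} <+> {..<n - k})" (is "_ = ?V")
    by (auto simp: R_graph_def bigraph_union_def complete_bigraph_def mk_bigraph_def)
  have A: "(u, v) \<in> parcs (ugraph (R_graph n k)) \<longleftrightarrow>
      u \<in> ?V \<and> v \<in> ?V \<and> (quarter u, quarter v) \<in> R_pattern" for u v
    by (cases u rule: quarter.cases; cases v rule: quarter.cases)
      (auto simp: R_graph_def bigraph_union_def complete_bigraph_def mk_bigraph_def
        R_pattern_def mem_map_prod)
  show ?thesis
    by (rule block_graphI[OF V])
      (use A card_quarter[of _ k k "n - k" "n - k"] quarter_less in \<open>simp_all add: finite_Plus\<close>)
qed

section \<open>Lower bounds for the spectral radii of the extremal graphs\<close>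

lemma sum_lessThan_4: "(\<Sum>j<4. h j) = h 0 + h 1 + h 2 + (h 3 :: real)" for h :: "nat \<Rightarrow> real"
  by (simp add: eval_nat_numeral)

lemma finite_pverts_block_graph: "block_graph G c R ns \<Longrightarrow> finite (pverts G)"
  by (simp add: block_graph_def)

text \<open>The indicator function of the second component is an eigenfunction.\<close>

lemma spectral_radius_R_ge:
  assumes "k < n"
  shows "real (n - k) \<le> graph_spectral_radius (ugraph (R_graph n k))"
proof (rule graph_spectral_radius_ge)
  let ?w = "\<lambda>i::nat. if i < 2 then 0 else 1 :: real"
  show "eigenfunction (pverts (ugraph (R_graph n k))) (parcs (ugraph (R_graph n k)))
      (real (n - k)) (\<lambda>v. ?w (quarter v))"
  proof (rule block_graph_eigenfunction[OF block_graph_R, where i = 2 and w = ?w])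
    fix i assume "i < length [k, k, n - k, n - k]"
    then have "i = 0 \<or> i = 1 \<or> i = 2 \<or> i = 3" by auto
    then show "(\<Sum>j<length [k, k, n - k, n - k]. if (i, j) \<in> R_pattern
        then real ([k, k, n - k, n - k] ! j) * ?w j else 0) = real (n - k) * ?w i"
      by (auto simp: sum_lessThan_4 R_pattern_def)
  qed (use assms in auto)
qed (rule finite_pverts_block_graph[OF block_graph_R])

text \<open>\<open>a\<close> is the entry of a quotient eigenvector at the \<open>k + 1\<close>
  vertices of degree \<open>k\<close>, and \<open>t\<close> the square of its eigenvalue.
  Eliminating the entries of the other part leaves the equation \<open>g a = 0\<close>, which has a
  root in the unit interval since \<open>g 0 \<le> 0 \<le> g 1\<close>.\<close>

lemma spectral_radius_Q_ge:
  assumes n: "Suc k < n"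
  obtains a t :: real where "k = 0 \<or> 0 < a" "0 \<le> a"
    "t = real n * real (n - Suc k) + k * Suc k * a"
    "k * (real (n - Suc k) + Suc k * a) = t * a"
    "0 < t" "sqrt t \<le> graph_spectral_radius (ugraph (Q_graph n k))"
proof -
  let ?p = "real (n - Suc k)"
  define T where "T a = real n * ?p + k * Suc k * a" for a :: real
  define g where "g a = T a * a - k * (?p + Suc k * a)" for a :: real
  have p: "0 < ?p" using n by simp
  have "\<exists>a\<ge>0. a \<le> 1 \<and> g a = 0"
  proof (rule IVT')
    show "g 0 \<le> 0" by (simp add: g_def)
    have "g 1 = (real n - k) * ?p" by (simp add: g_def T_def algebra_simps)
    then show "0 \<le> g 1" using n by simp
    show "continuous_on {0..1} g" unfolding g_def T_def by (intro continuous_intros)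
  qed simp
  then obtain a where a: "0 \<le> a" "g a = 0" by blast
  have T: "0 < T a" unfolding T_def using n p a by (intro add_pos_nonneg) auto
  have ka: "k = 0 \<or> 0 < a"
  proof (rule ccontr)
    assume no: "\<not> (k = 0 \<or> 0 < a)"
    then have "a = 0" using a by simp
    then show False using a(2) p no by (simp add: g_def)
  qed
  have Ta: "k * (?p + Suc k * a) = T a * a" using a by (simp add: g_def)
  define l where "l = sqrt (T a)"
  have l: "0 < l" "l * l = T a" using T by (simp_all add: l_def)
  \<comment> \<open>The quotient eigenvector, scaled to be \<open>1\<close> on the vertices adjacent to all of the other part.\<close>
  define w where "w = (!) [(?p + Suc k * a) / l, 1, ?p / l, a]"
  have W: "w 0 = (?p + Suc k * a) / l" "w 1 = 1" "w 2 = ?p / l" "w 3 = a"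
    by (simp_all add: w_def eval_nat_numeral)
  let ?ns = "[k, n - k - 1, n - k, k + 1]"
  have ns: "real (?ns ! 0) = k" "real (?ns ! 1) = ?p" "real (?ns ! 2) = real n - k"
    "real (?ns ! 3) = Suc k" "length ?ns = 4"
    using n by (simp_all add: eval_nat_numeral)
  have "l \<le> graph_spectral_radius (ugraph (Q_graph n k))"
  proof (rule graph_spectral_radius_ge)
    show "eigenfunction (pverts (ugraph (Q_graph n k))) (parcs (ugraph (Q_graph n k))) l
        (\<lambda>v. w (quarter v))"
    proof (rule block_graph_eigenfunction[OF block_graph_Q, where i = 1 and w = w])
      fix i assume "i < length ?ns"
      then have "i = 0 \<or> i = 1 \<or> i = 2 \<or> i = 3" by auto
      moreover have "?p * 1 + Suc k * a = l * ((?p + Suc k * a) / l)" using l by simp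
      moreover have "k * ((?p + Suc k * a) / l) + (real n - k) * (?p / l) = l * 1"
      proof -
        have "k * ((?p + Suc k * a) / l) + (real n - k) * (?p / l) = T a / l"
          by (simp add: T_def field_simps add_divide_distrib[symmetric])
        then show ?thesis using l by (simp add: field_simps)
      qed
      moreover have "?p * 1 = l * (?p / l)" using l by simp
      moreover have "k * ((?p + Suc k * a) / l) = l * a"
        using l Ta by (simp add: field_simps)
      ultimately show "(\<Sum>j<length ?ns. if (i, j) \<in> Q_pattern then real (?ns ! j) * w j else 0) = l * w i"
        unfolding ns(5) sum_lessThan_4 ns(1-4)
        by (elim disjE) (simp_all only: W, simp_all add: Q_pattern_def W)
    qed (use n W in auto)
  qed (rule finite_pverts_block_graph[OF block_graph_Q])
  then show thesis
    using that[of a "T a"] ka a T Ta by (simp add: T_def l_def)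
qed

section \<open>Recognising the extremal graphs, and the structure of graphs without spanning
  path\<close>

context balanced_bip
begin

text \<open>Here \<open>X\<close> corresponds to the second part of \<open>Q_graph n k\<close>, made
  up of classes \<open>1\<close> and \<open>3\<close>; isomorphism of the underlying graphs does not
  see the bipartition.\<close>

lemma block_graph_of_Q_shape:
  assumes G: "pverts G = X \<union> Y" "parcs G = E \<union> E\<inverse>"
    and "X0 \<subseteq> X" "card X0 = Suc k" "F \<subseteq> Y" "card F = k"
    and E: "E = (X - X0) \<times> Y \<union> X0 \<times> F"
  shows "block_graph G (\<lambda>v. if v \<in> F then 0 else if v \<in> X0 then 3 else if v \<in> X then 1 else 2)
    Q_pattern [k, n - k - 1, n - k, k + 1]" (is "block_graph G ?c _ _")
proof -
  have fin: "finite X0" "finite F" using assms finite_X finite_Y finite_subset by blast+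
  have sets: "{v \<in> X \<union> Y. ?c v = 0} = F" "{v \<in> X \<union> Y. ?c v = 1} = X - X0"
    "{v \<in> X \<union> Y. ?c v = 2} = Y - F" "{v \<in> X \<union> Y. ?c v = 3} = X0"
    using assms(3,5) disjoint by auto
  have card: "card {v \<in> X \<union> Y. ?c v = i} = [k, n - k - 1, n - k, k + 1] ! i" if "i < 4" for i
  proof -
    have "i = 0 \<or> i = 1 \<or> i = 2 \<or> i = 3" using that by auto
    then show ?thesis
      by (elim disjE) (simp_all only: sets,
        simp_all add: card_Diff_subset fin assms(3-6) card_X card_Y)
  qed
  have "(u, v) \<in> parcs G \<longleftrightarrow> u \<in> X \<union> Y \<and> v \<in> X \<union> Y \<and> (?c u, ?c v) \<in> Q_pattern" for u v
  proof -
    have D: "x \<notin> Y" if "x \<in> X" for x using disjoint that by blast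
    have "(u, v) \<in> parcs G \<longleftrightarrow> (u \<in> X - X0 \<and> v \<in> Y) \<or> (u \<in> X0 \<and> v \<in> F) \<or>
        (v \<in> X - X0 \<and> u \<in> Y) \<or> (v \<in> X0 \<and> u \<in> F)"
      unfolding G(2) E by auto
    moreover have "u \<in> F \<Longrightarrow> u \<in> Y" "v \<in> F \<Longrightarrow> v \<in> Y" "u \<in> X0 \<Longrightarrow> u \<in> X" "v \<in> X0 \<Longrightarrow> v \<in> X"
      using assms(3,5) by blast+
    ultimately show ?thesis
      using D[of u] D[of v] by (auto simp: Q_pattern_def split: if_splits)
  qed
  then show ?thesis
    by (intro block_graphI[OF G(1)]) (use finite_X finite_Y card in auto)
qed

lemma block_graph_of_R_shape:
  assumes G: "pverts G = X \<union> Y" "parcs G = E \<union> E\<inverse>"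
    and xy: "x0 \<in> X" "y0 \<in> Y"
    and E: "E = {(x0, y0)} \<union> (X - {x0}) \<times> (Y - {y0})"
  shows "block_graph G (\<lambda>v. if v = x0 then 0 else if v = y0 then 1 else if v \<in> X then 2 else 3)
    R_pattern [1, 1, n - 1, n - 1]" (is "block_graph G ?c _ _")
proof -
  have ne: "x0 \<noteq> y0" "x0 \<notin> Y" "y0 \<notin> X" using xy disjoint by blast+
  have sets: "{v \<in> X \<union> Y. ?c v = 0} = {x0}" "{v \<in> X \<union> Y. ?c v = 1} = {y0}"
    "{v \<in> X \<union> Y. ?c v = 2} = X - {x0}" "{v \<in> X \<union> Y. ?c v = 3} = Y - {y0}"
    using xy ne disjoint by auto
  have card: "card {v \<in> X \<union> Y. ?c v = i} = [1, 1, n - 1, n - 1] ! i" if "i < 4" for i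
  proof -
    have "i = 0 \<or> i = 1 \<or> i = 2 \<or> i = 3" using that by auto
    then show ?thesis
      by (elim disjE) (simp_all only: sets, simp_all add: xy card_X card_Y finite_X finite_Y)
  qed
  have "(u, v) \<in> parcs G \<longleftrightarrow> u \<in> X \<union> Y \<and> v \<in> X \<union> Y \<and> (?c u, ?c v) \<in> R_pattern" for u v
  proof -
    have D: "x \<notin> Y" if "x \<in> X" for x using disjoint that by blast
    have "(u, v) \<in> parcs G \<longleftrightarrow> (u = x0 \<and> v = y0) \<or> (u \<in> X - {x0} \<and> v \<in> Y - {y0}) \<or>
        (v = x0 \<and> u = y0) \<or> (v \<in> X - {x0} \<and> u \<in> Y - {y0})"
      unfolding G(2) E by auto
    then show ?thesis
      using D[of u] D[of v] xy ne by (auto simp: R_pattern_def split: if_splits)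
  qed
  then show ?thesis
    by (intro block_graphI[OF G(1)]) (use finite_X finite_Y card in auto)
qed

text \<open>The closure \<open>H\<close> has at least the degrees and edges of \<open>E\<close>, so
  \<open>low_degree_structure\<close> applies to it. Upper bounds on degrees pass back to
  \<open>E\<close>; an isolated edge of \<open>H\<close> passes back as inclusions, as
  \<open>E\<close> may lack it.\<close>

lemma not_spannable_structure:
  assumes ns: "\<not> spannable (X \<union> Y) E"
    and n: "(k + 2)\<^sup>2 \<le> n" and e: "n * n \<le> card E + n * (k + 1)"
    and degX: "\<And>x. x \<in> X \<Longrightarrow> k \<le> card (E `` {x})"
    and degY: "\<And>y. y \<in> Y \<Longrightarrow> k \<le> card (E\<inverse> `` {y})"
  shows "(\<exists>X0\<subseteq>X. card X0 = Suc k \<and> (\<forall>x\<in>X0. card (E `` {x}) \<le> k)) \<or>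
    (\<exists>Y0\<subseteq>Y. card Y0 = Suc k \<and> (\<forall>y\<in>Y0. card (E\<inverse> `` {y}) \<le> k)) \<or>
    (k = 1 \<and> (\<exists>x\<in>X. \<exists>y\<in>Y. E `` {x} \<subseteq> {y} \<and> E\<inverse> `` {y} \<subseteq> {x}))"
proof -
  obtain H where H: "E \<subseteq> H" "H \<subseteq> X \<times> Y" "\<not> spannable (X \<union> Y) H"
    "\<And>x y. x \<in> X \<Longrightarrow> y \<in> Y \<Longrightarrow> (x, y) \<notin> H \<Longrightarrow> card (H `` {x}) + card (H\<inverse> `` {y}) \<le> n"
    using obtain_closure[OF ns] by blast
  interpret H: closed_bip X Y H n
    by unfold_locales (use finite_X finite_Y disjoint card_X card_Y H in auto)
  have mono: "E `` {x} \<subseteq> H `` {x}" "E\<inverse> `` {y} \<subseteq> H\<inverse> `` {y}" for x y using H(1) by auto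
  have le: "card (E `` {x}) \<le> card (H `` {x})" "card (E\<inverse> `` {y}) \<le> card (H\<inverse> `` {y})" for x y
    using mono by (simp_all add: card_mono)
  have "card E \<le> card H" using H(1) H.finite_E by (rule card_mono[rotated])
  then have "n * n \<le> card H + n * (k + 1)" using e by linarith
  then have "(\<exists>X0\<subseteq>X. card X0 = Suc k \<and> (\<forall>x\<in>X0. card (H `` {x}) \<le> k)) \<or>
    (\<exists>Y0\<subseteq>Y. card Y0 = Suc k \<and> (\<forall>y\<in>Y0. card (H\<inverse> `` {y}) \<le> k)) \<or>
    (k = 1 \<and> (\<exists>x\<in>X. \<exists>y\<in>Y. H `` {x} = {y} \<and> H\<inverse> `` {y} = {x}))"
    by (rule H.low_degree_structure[OF n _ order_trans[OF degX le(1)] order_trans[OF degY le(2)]])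
  then show ?thesis
  proof (elim disjE)
    assume "\<exists>X0\<subseteq>X. card X0 = Suc k \<and> (\<forall>x\<in>X0. card (H `` {x}) \<le> k)"
    then show ?thesis using order_trans[OF le(1)] by (intro disjI1) blast
  next
    assume "\<exists>Y0\<subseteq>Y. card Y0 = Suc k \<and> (\<forall>y\<in>Y0. card (H\<inverse> `` {y}) \<le> k)"
    then show ?thesis using order_trans[OF le(2)] by (intro disjI2 disjI1) blast
  next
    assume "k = 1 \<and> (\<exists>x\<in>X. \<exists>y\<in>Y. H `` {x} = {y} \<and> H\<inverse> `` {y} = {x})"
    then obtain x y where "k = 1" "x \<in> X" "y \<in> Y" "H `` {x} = {y}" "H\<inverse> `` {y} = {x}" by blast
    then have "k = 1 \<and> x \<in> X \<and> y \<in> Y \<and> E `` {x} \<subseteq> {y} \<and> E\<inverse> `` {y} \<subseteq> {x}"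
      using mono(1)[of x] mono(2)[of y] by simp
    then show ?thesis by blast
  qed
qed

end

section \<open>Spectral consequences of the low-degree structures\<close>

context bip_eigenfunction
begin

lemma missing_edges_bound:
  assumes "real n * real (n - Suc k) \<le> \<mu>\<^sup>2" "k < n"
  shows "n * n \<le> card E + n * (k + 1)"
proof -
  have "real (n * (n - Suc k)) \<le> real (card E)"
    using order_trans[OF assms(1) square_le_card] by simp
  then have "n * (n - Suc k) \<le> card E" by (simp only: of_nat_le_iff)
  moreover have "n * n = n * (n - Suc k) + n * (k + 1)"
  proof -
    have "n - Suc k + (k + 1) = n" using assms(2) by simp
    then show ?thesis by (metis add_mult_distrib2)
  qed
  ultimately show ?thesis by linarith
qed

end

context bip_eigenfunction
begin

lemma isomorphic_Q:
  fixes a t :: real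
  assumes G: "pverts G = X \<union> Y" "parcs G = E \<union> E\<inverse>"
    and X0: "\<exists>X0\<subseteq>X. card X0 = Suc k \<and> (\<forall>x\<in>X0. card (E `` {x}) \<le> k)"
    and n: "Suc k < n" and a: "k = 0 \<or> 0 < a" "0 \<le> a" and t: "0 < t" "t \<le> \<mu>\<^sup>2"
    and ta: "t = real n * real (n - Suc k) + k * Suc k * a"
      "k * (real (n - Suc k) + Suc k * a) = t * a"
  shows "isomorphic G (ugraph (Q_graph n k))"
proof -
  obtain X0 where X0: "X0 \<subseteq> X" "card X0 = Suc k" "\<And>x. x \<in> X0 \<Longrightarrow> card (E `` {x}) \<le> k"
    using X0 by blast
  \<comment> \<open>For \<open>k = 0\<close> the Perron vector of \<open>Q_graph n k\<close> vanishes on the isolated vertex,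
    where any positive weight will do.\<close>
  define b where "b = (if k = 0 then 1 else a)"
  have "\<exists>F\<subseteq>Y. card F = k \<and> E = (X - X0) \<times> Y \<union> X0 \<times> F"
    by (rule conjunct2[OF low_degree_extremal[OF X0 n _ t, of b]])
      (use a ta t in \<open>auto simp: b_def\<close>)
  then obtain F where F: "F \<subseteq> Y" "card F = k" "E = (X - X0) \<times> Y \<union> X0 \<times> F" by blast
  show ?thesis
    by (rule block_graph_isomorphic[OF block_graph_of_Q_shape[OF G X0(1,2) F] block_graph_Q])
qed

text \<open>Weight \<open>1 / 3\<close> bounds the walk sums outside \<open>X0\<close> by
  \<open>n * (n - 2) + 2 / 3\<close>, below \<open>(n - 1)\<^sup>2 = n * (n - 2) + 1\<close>, so the
  equality that \<open>low_degree_extremal\<close> demands fails.\<close>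

lemma two_pendants_bound:
  assumes X0: "\<exists>X0\<subseteq>X. card X0 = Suc 1 \<and> (\<forall>x\<in>X0. card (E `` {x}) \<le> 1)" and n: "9 \<le> n"
  shows "\<mu>\<^sup>2 < (real n - 1)\<^sup>2"
proof (rule ccontr)
  assume "\<not> \<mu>\<^sup>2 < (real n - 1)\<^sup>2"
  then have \<mu>: "(real n - 1)\<^sup>2 \<le> \<mu>\<^sup>2" by simp
  obtain X0 where X0: "X0 \<subseteq> X" "card X0 = Suc 1" "\<And>x. x \<in> X0 \<Longrightarrow> card (E `` {x}) \<le> 1"
    using X0 by blast
  have p: "real (n - Suc 1) = real n - 2" using n by simp
  have "0 \<le> (real n - 9) * (real n - 1)" using n by (intro mult_nonneg_nonneg) auto
  \<comment> \<open>Gives the condition inside \<open>X0\<close>, which amounts to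
    \<open>3 * (n - 2) + 2 \<le> (n - 1)\<^sup>2\<close>.\<close>
  then have sq: "8 * (real n - 1) \<le> (real n - 1)\<^sup>2" by (simp add: power2_eq_square algebra_simps)
  have "(real n - 1)\<^sup>2 = real n * real (n - Suc 1) + real (1 * Suc 1) * (1 / 3)"
    by (rule conjunct1[OF low_degree_extremal[OF X0 _ _ _ \<mu>]])
      (use n sq p in \<open>auto simp: power2_eq_square algebra_simps\<close>)
  then show False using p by (simp add: power2_eq_square algebra_simps)
qed

end

section \<open>From the spectral hypotheses to traceability or the extremal graphs\<close>

theorem theorem2p1:
  fixes G :: "'a bigraph" and n k :: nat
  assumes "n \<ge> (k + 2)\<^sup>2"
    and "bipartite_graph G"
    and "balanced G"
    and "card (pverts (ugraph G)) = 2 * n"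
    and "min_degree (ugraph G) \<ge> k"
  shows "(k \<noteq> 1 \<and> graph_spectral_radius (ugraph G) \<ge> graph_spectral_radius (ugraph (Q_graph n k)) \<longrightarrow>
            traceable (ugraph G) \<or> isomorphic (ugraph G) (ugraph (Q_graph n k))) \<and>
         (k = 1 \<and> graph_spectral_radius (ugraph G) \<ge> graph_spectral_radius (ugraph (R_graph n 1)) \<longrightarrow>
            traceable (ugraph G) \<or> isomorphic (ugraph G) (ugraph (R_graph n 1)))"
proof -
  define X where "X = part_X G"
  define Y where "Y = part_Y G"
  define E where "E = parcs (ugraph G) \<inter> X \<times> Y"
  define \<mu> where "\<mu> = graph_spectral_radius (ugraph G)"
  have n: "(k + 2)\<^sup>2 \<le> n" and kn: "Suc k < n" "0 < n"
    using assms(1) by (simp_all add: power2_eq_square)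
  have B: "finite X" "finite Y" "pverts (ugraph G) = X \<union> Y" "X \<inter> Y = {}"
    "parcs (ugraph G) \<subseteq> X \<times> Y \<union> Y \<times> X" "sym (parcs (ugraph G))"
    using assms(2) by (simp_all add: bipartite_graph_iff X_def Y_def)
  have "card X = card Y" using assms(3) by (simp add: balanced_def X_def Y_def)
  then have cards: "card X = n" "card Y = n"
    using assms(4) B by (simp_all add: card_Un_disjoint)
  have bip: "balanced_bip X Y E n"
    by unfold_locales (use B cards in \<open>auto simp: E_def\<close>)
  interpret balanced_bip X Y E n by (rule bip)
  have arcs: "parcs (ugraph G) = E \<union> E\<inverse>"
  proof
    show "parcs (ugraph G) \<subseteq> E \<union> E\<inverse>"
      using B(5) symD[OF B(6)] by (auto simp: E_def)
    show "E \<union> E\<inverse> \<subseteq> parcs (ugraph G)"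
      using symD[OF B(6)] by (auto simp: E_def)
  qed
  have deg: "k \<le> out_degree (with_proj (ugraph G)) v" if "v \<in> X \<union> Y" for v
  proof -
    have "min_degree (ugraph G) \<le> out_degree (with_proj (ugraph G)) v"
      unfolding min_degree_def B(3) using that B(1,2) by (intro Min_le) auto
    then show ?thesis using assms(5) by simp
  qed
  have out: "out_degree (with_proj (ugraph G)) v = card (parcs (ugraph G) `` {v})" for v
  proof -
    have "out_arcs (with_proj (ugraph G)) v = Pair v ` (parcs (ugraph G) `` {v})"
      by (auto simp: out_arcs_def image_iff)
    then show ?thesis by (simp add: out_degree_def card_image inj_on_def)
  qed
  have degX: "k \<le> card (E `` {x})" if "x \<in> X" for x
  proof -
    have "parcs (ugraph G) `` {x} = E `` {x}" unfolding arcs using that E_sub disjoint by auto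
    then show ?thesis using deg[of x] out that by simp
  qed
  have degY: "k \<le> card (E\<inverse> `` {y})" if "y \<in> Y" for y
  proof -
    have "parcs (ugraph G) `` {y} = E\<inverse> `` {y}" unfolding arcs using that E_sub disjoint by auto
    then show ?thesis using deg[of y] out that by simp
  qed
  have trace: "traceable (ugraph G)" if sp: "spannable (X \<union> Y) E"
  proof -
    obtain p where p: "path_in E p" "set p = X \<union> Y" using sp by (auto simp: spannable_def)
    have "set (vwalk_arcs q) \<subseteq> parcs (ugraph G)" if "successively (edge E) q" for q
      using that unfolding arcs by (induction q rule: vwalk_arcs.induct) (auto simp: edge_def)
    moreover have "p \<noteq> []" using p(2) cards kn by auto
    ultimately have "vpath p (with_proj (ugraph G))"
      using p by (auto simp: vpath_def vwalk_def path_in_def B(3))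
    then show ?thesis unfolding traceable_def using p(2) B(3) by blast
  qed
  have ne: "X \<union> Y \<noteq> {}" using cards kn by auto
  obtain f where f: "eigenfunction (X \<union> Y) (E \<union> E\<inverse>) \<mu> f"
    using graph_spectral_radius_eigenfunction[of "ugraph G"] B ne unfolding arcs \<mu>_def by auto
  have eig: "bip_eigenfunction X Y E n \<mu> f" if "0 < \<mu>"
    by unfold_locales (use f that in auto)
  have iso_Q: "isomorphic (ugraph G) (ugraph (Q_graph n k))"
    if k1: "k \<noteq> 1" and ge: "graph_spectral_radius (ugraph (Q_graph n k)) \<le> \<mu>"
      and nt: "\<not> traceable (ugraph G)"
  proof -
    obtain a t :: real where at: "k = 0 \<or> 0 < a" "0 \<le> a"
        "t = real n * real (n - Suc k) + k * Suc k * a"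
        "k * (real (n - Suc k) + Suc k * a) = t * a"
        "0 < t" "sqrt t \<le> graph_spectral_radius (ugraph (Q_graph n k))"
      using spectral_radius_Q_ge[OF kn(1)] by metis
    have st: "sqrt t \<le> \<mu>" "0 < sqrt t" using at ge by auto
    have t\<mu>: "t \<le> \<mu>\<^sup>2" using st at(5) by (simp add: real_sqrt_le_iff sqrt_le_D)
    interpret M: bip_eigenfunction X Y E n \<mu> f using eig st by simp
    interpret S: bip_eigenfunction Y X "E\<inverse>" n \<mu> f by (rule M.swapped_eigenfunction)
    \<comment> \<open>Because \<open>a\<close> is nonnegative, \<open>t\<close> is at least
      \<open>n * (n - Suc k)\<close>, which is the edge count that the structure lemma asks
      for.\<close>
    have "real n * real (n - Suc k) \<le> \<mu>\<^sup>2" using t\<mu> at(2,3) by (smt (verit) mult_nonneg_nonneg of_nat_0_le_iff)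
    then have dense: "n * n \<le> card E + n * (k + 1)" using M.missing_edges_bound kn by simp
    have "\<not> spannable (X \<union> Y) E" using trace nt by blast
    from not_spannable_structure[OF this n dense degX degY] k1
    consider "\<exists>X0\<subseteq>X. card X0 = Suc k \<and> (\<forall>x\<in>X0. card (E `` {x}) \<le> k)"
      | "\<exists>Y0\<subseteq>Y. card Y0 = Suc k \<and> (\<forall>y\<in>Y0. card (E\<inverse> `` {y}) \<le> k)" by blast
    then show ?thesis
    proof cases
      case 1
      show ?thesis by (rule M.isomorphic_Q[OF B(3) arcs 1 kn(1) at(1,2,5) t\<mu> at(3,4)])
    next
      case 2
      have "pverts (ugraph G) = Y \<union> X" "parcs (ugraph G) = E\<inverse> \<union> (E\<inverse>)\<inverse>"
        using B(3) arcs by auto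
      from S.isomorphic_Q[OF this 2 kn(1) at(1,2,5) t\<mu> at(3,4)] show ?thesis .
    qed
  qed
  have iso_R: "isomorphic (ugraph G) (ugraph (R_graph n 1))"
    if k1: "k = 1" and ge: "graph_spectral_radius (ugraph (R_graph n 1)) \<le> \<mu>"
      and nt: "\<not> traceable (ugraph G)"
  proof -
    have n9: "9 \<le> n" using n k1 by (simp add: power2_eq_square)
    have \<mu>1: "real n - 1 \<le> \<mu>" using order_trans[OF spectral_radius_R_ge ge] n9 by simp
    have \<mu>: "(real n - 1)\<^sup>2 \<le> \<mu>\<^sup>2" using \<mu>1 n9 by (intro power_mono) auto
    interpret M: bip_eigenfunction X Y E n \<mu> f using eig \<mu>1 n9 by simp
    interpret S: bip_eigenfunction Y X "E\<inverse>" n \<mu> f by (rule M.swapped_eigenfunction)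
    have "real n * real (n - Suc k) \<le> (real n - 1)\<^sup>2"
      using n9 k1 by (simp add: power2_eq_square algebra_simps of_nat_diff)
    then have dense: "n * n \<le> card E + n * (k + 1)" using M.missing_edges_bound \<mu> kn by simp
    have "\<not> spannable (X \<union> Y) E" using trace nt by blast
    from not_spannable_structure[OF this n dense degX degY]
    \<comment> \<open>Two vertices of degree at most \<open>1\<close> in either part would make
      \<open>\<mu>\<close> too small, so the isolated edge remains.\<close>
    have "\<exists>x\<in>X. \<exists>y\<in>Y. E `` {x} \<subseteq> {y} \<and> E\<inverse> `` {y} \<subseteq> {x}"
      using M.two_pendants_bound[OF _ n9] S.two_pendants_bound[OF _ n9] \<mu> unfolding k1
      by (meson linorder_not_less)
    then obtain x0 y0 where xy: "x0 \<in> X" "y0 \<in> Y" "E `` {x0} \<subseteq> {y0}" "E\<inverse> `` {y0} \<subseteq> {x0}" by blast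
    \<comment> \<open>Minimum degree \<open>1\<close> turns the inclusions inherited from the
      closure into equalities.\<close>
    have "E `` {x0} \<noteq> {}" using degX[OF xy(1)] k1 by auto
    then have iso: "E `` {x0} = {y0}" "E\<inverse> `` {y0} = {x0}" using xy(3,4) by auto
    have "E = {(x0, y0)} \<union> (X - {x0}) \<times> (Y - {y0})"
      using M.isolated_edge_extremal[OF xy(1,2) iso _ \<mu>] n9 by simp
    from block_graph_of_R_shape[OF B(3) arcs xy(1,2) this] show ?thesis
      by (rule block_graph_isomorphic[OF _ block_graph_R])
  qed
  show ?thesis using iso_Q iso_R unfolding \<mu>_def by blast
qed

end
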